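(* Let $\vec r=(r_1,\dots,r_d)\in\mathbb{R}^d$. Then the domain of $\Delta_{\mathbb{Z}^d}^{\vec r}$ in $\ell^2(\mathbb{Z}^d)$ is $$\mathcal D\big(\Delta_{\mathbb{Z}^d}^{\vec r}\big)=\bigcap_{j=1}^d\Big(\mathrm{id}^{\otimes(j-1)}\otimes\mathcal D(\Delta_{\mathbb{Z}}^{r_j})\otimes\mathrm{id}^{\otimes(d-j)}\Big),$$ where the $j$-th set denotes the domain of $\mathrm{id}^{\otimes(j-1)}\otimes\Delta_{\mathbb{Z}}^{r_j}\otimes\mathrm{id}^{\otimes(d-j)}$. Moreover: if all $r_j\ge0$, then $\mathcal D(\Delta_{\mathbb{Z}^d}^{\vec r})=\ell^2(\mathbb{Z}^d)$; if at least one $r_j<0$, then $\mathcal D(\Delta_{\mathbb{Z}^d}^{\vec r})\subsetneq\ell^2(\mathbb{Z}^d)$.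
   Context: $\Delta_{\mathbb{Z}}=2\,\mathrm{id}-U-U^*$ on $\ell^2(\mathbb{Z})$, with $U$ the unit shift; under the discrete Fourier transform it is multiplication by $2-2\cos\theta$ on $L^2([-\pi,\pi])$. For $r\in\mathbb{R}$, $\Delta_{\mathbb{Z}}^r$ is defined by Borel functional calculus (multiplication by $(2-2\cos\theta)^r$ on its maximal domain). $\Delta_{\mathbb{Z}^d}^{\vec r}=\sum_{j=1}^d\mathrm{id}^{\otimes(j-1)}\otimes\Delta_{\mathbb{Z}}^{r_j}\otimes\mathrm{id}^{\otimes(d-j)}$ on $\ell^2(\mathbb{Z}^d)=\ell^2(\mathbb{Z})^{\otimes d}$; under Fourier transform it is the self-adjoint multiplication operator by $\sum_{j=1}^d(2-2\cos\theta_j)^{r_j}$ on $L^2([-\pi,\pi]^d)$, with its maximal domain. *)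

theory Defs
  imports "HOL-Analysis.Analysis"
begin

text \<open>
  Unbounded operators are represented by their graphs, so that the domain of an operator is the
  \<^const>\<open>Domain\<close> of its graph. The dimension \<open>d\<close> is the cardinality of a type \<open>'d::finite\<close>; the
  lattice \<open>\<int>\<^sup>d\<close> is \<open>'d \<Rightarrow> int\<close> and the cube \<open>[-\<pi>, \<pi>]\<^sup>d\<close> is a set of functions \<open>'d \<Rightarrow> real\<close>.
\<close>

definition ell2 :: "('n \<Rightarrow> complex) set" where
  "ell2 = {f. (\<lambda>n. (cmod (f n))\<^sup>2) summable_on UNIV}"

definition ell2_norm :: "('n \<Rightarrow> complex) \<Rightarrow> real" where
  "ell2_norm f = sqrt (\<Sum>\<^sub>\<infinity>n. (cmod (f n))\<^sup>2)"

text \<open>Elements of \<open>L\<^sup>2\<close> are represented by functions, not by classes of functions equal a.e.\<close>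

definition L2 :: "'x measure \<Rightarrow> ('x \<Rightarrow> complex) set" where
  "L2 M = {g \<in> borel_measurable M. integrable M (\<lambda>x. (cmod (g x))\<^sup>2)}"

text \<open>
  The discrete Fourier transform with respect to a system \<open>e\<close> of characters:
  \<open>has_dft M e f g\<close> says that \<open>g\<close> represents \<open>\<Sum>\<^sub>n f(n) e\<^sub>n\<close>, the sum converging
  unconditionally in \<open>L\<^sup>2(M)\<close>. It is a relation because \<open>g\<close> is only determined a.e.
\<close>

definition has_dft ::
    "'x measure \<Rightarrow> ('n \<Rightarrow> 'x \<Rightarrow> complex) \<Rightarrow> ('n \<Rightarrow> complex) \<Rightarrow> ('x \<Rightarrow> complex) \<Rightarrow> bool" where
  "has_dft M e f g \<longleftrightarrow> g \<in> L2 M \<and>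
     ((\<lambda>F. \<integral>x. (cmod (g x - (\<Sum>n\<in>F. f n * e n x)))\<^sup>2 \<partial>M) \<longlongrightarrow> 0) (finite_subsets_at_top UNIV)"

text \<open>Multiplication by a real function on its maximal domain.\<close>

definition mult_op :: "'x measure \<Rightarrow> ('x \<Rightarrow> real) \<Rightarrow> (('x \<Rightarrow> complex) \<times> ('x \<Rightarrow> complex)) set" where
  "mult_op M m = {(g, k). g \<in> L2 M \<and> k \<in> L2 M \<and> k = (\<lambda>x. of_real (m x) * g x)}"

definition fourier_multiplier ::
    "'x measure \<Rightarrow> ('n \<Rightarrow> 'x \<Rightarrow> complex) \<Rightarrow> ('x \<Rightarrow> real) \<Rightarrow> (('n \<Rightarrow> complex) \<times> ('n \<Rightarrow> complex)) set" where
  "fourier_multiplier M e m =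
     {(f, h). f \<in> ell2 \<and> h \<in> ell2 \<and>
        (\<exists>g k. (g, k) \<in> mult_op M m \<and> has_dft M e f g \<and> has_dft M e h k)}"

definition circle_measure :: "real measure" where
  "circle_measure = restrict_space lborel {-pi..pi}"

text \<open>The factor \<open>1 / sqrt (2 * pi)\<close> makes the characters orthonormal, hence the transform unitary.\<close>

definition circle_char :: "int \<Rightarrow> real \<Rightarrow> complex" where
  "circle_char n \<theta> = cis (of_int n * \<theta>) / of_real (sqrt (2 * pi))"

definition torus_measure :: "('d::finite \<Rightarrow> real) measure" where
  "torus_measure = Pi\<^sub>M UNIV (\<lambda>_. circle_measure)"

definition torus_char :: "('d::finite \<Rightarrow> int) \<Rightarrow> ('d \<Rightarrow> real) \<Rightarrow> complex" where
  "torus_char n \<theta> = (\<Prod>i\<in>UNIV. circle_char (n i) (\<theta> i))"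

definition laplacian :: "(int \<Rightarrow> complex) \<Rightarrow> int \<Rightarrow> complex" where
  "laplacian f n = 2 * f n - f (n - 1) - f (n + 1)"

text \<open>
  The symbol of \<^const>\<open>laplacian\<close>, see \<open>has_dft_laplacian\<close> below. The Borel functional calculus
  of \<open>\<Delta>\<close> applies a function to this symbol. At the zero of the symbol, \<open>powr\<close> gives
  \<open>0 powr r = 0\<close> for every \<open>r\<close>, including \<open>r \<le> 0\<close>; this affects a null set only.
\<close>

definition laplacian_symbol :: "real \<Rightarrow> real" where
  "laplacian_symbol \<theta> = 2 - 2 * cos \<theta>"

definition laplacian_pow :: "real \<Rightarrow> ((int \<Rightarrow> complex) \<times> (int \<Rightarrow> complex)) set" where
  "laplacian_pow r = fourier_multiplier circle_measure circle_char (\<lambda>\<theta>. laplacian_symbol \<theta> powr r)"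

definition laplacian_pow_lattice ::
    "('d::finite \<Rightarrow> real) \<Rightarrow> ((('d \<Rightarrow> int) \<Rightarrow> complex) \<times> (('d \<Rightarrow> int) \<Rightarrow> complex)) set" where
  "laplacian_pow_lattice r =
     fourier_multiplier torus_measure torus_char (\<lambda>\<theta>. \<Sum>j\<in>UNIV. laplacian_symbol (\<theta> j) powr r j)"

definition tensor :: "('d::finite \<Rightarrow> int \<Rightarrow> complex) \<Rightarrow> ('d \<Rightarrow> int) \<Rightarrow> complex" where
  "tensor \<phi> n = (\<Prod>i\<in>UNIV. \<phi> i (n i))"

text \<open>
  The operator \<open>id \<otimes> \<dots> \<otimes> A \<otimes> \<dots> \<otimes> id\<close> with \<open>A\<close> in slot \<open>j\<close>: first on the algebraic tensor
  product (finite sums of elementary tensors whose \<open>j\<close>-th factor lies in the domain of \<open>A\<close>), then,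
  as usual for tensor products of closed unbounded operators, its closure.
\<close>

definition alg_tensor_slot ::
    "'d \<Rightarrow> ((int \<Rightarrow> complex) \<times> (int \<Rightarrow> complex)) set \<Rightarrow>
     ((('d::finite \<Rightarrow> int) \<Rightarrow> complex) \<times> (('d \<Rightarrow> int) \<Rightarrow> complex)) set" where
  "alg_tensor_slot j A =
     {(\<lambda>n. \<Sum>k<N. tensor (\<phi> k) n, \<lambda>n. \<Sum>k<N. tensor ((\<phi> k)(j := v k)) n) | (N::nat) \<phi> v.
        \<forall>k<N. (\<forall>i. \<phi> k i \<in> ell2) \<and> (\<phi> k j, v k) \<in> A}"

definition ell2_closure ::
    "(('n \<Rightarrow> complex) \<times> ('n \<Rightarrow> complex)) set \<Rightarrow> (('n \<Rightarrow> complex) \<times> ('n \<Rightarrow> complex)) set" where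
  "ell2_closure G =
     {(f, h). f \<in> ell2 \<and> h \<in> ell2 \<and>
        (\<exists>u w. (\<forall>k::nat. (u k, w k) \<in> G) \<and>
               (\<lambda>k. ell2_norm (\<lambda>n. u k n - f n)) \<longlonglongrightarrow> 0 \<and>
               (\<lambda>k. ell2_norm (\<lambda>n. w k n - h n)) \<longlonglongrightarrow> 0)}"

definition tensor_slot ::
    "'d \<Rightarrow> ((int \<Rightarrow> complex) \<times> (int \<Rightarrow> complex)) set \<Rightarrow>
     ((('d::finite \<Rightarrow> int) \<Rightarrow> complex) \<times> (('d \<Rightarrow> int) \<Rightarrow> complex)) set" where
  "tensor_slot j A = ell2_closure (alg_tensor_slot j A)"


text \<open>The transform turns \<open>\<Delta> = 2 id - U - U\<^sup>*\<close> into multiplication by its symbol.\<close>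

lemma L2_add:
  assumes "a \<in> L2 M" "b \<in> L2 M"
  shows "(\<lambda>x. a x + b x) \<in> L2 M"
proof -
  have [measurable]: "a \<in> borel_measurable M" "b \<in> borel_measurable M"
    using assms by (auto simp: L2_def)
  have "integrable M (\<lambda>x. 2 * (cmod (a x))\<^sup>2 + 2 * (cmod (b x))\<^sup>2)"
    using assms by (auto simp: L2_def)
  moreover have "(cmod (a x + b x))\<^sup>2 \<le> 2 * (cmod (a x))\<^sup>2 + 2 * (cmod (b x))\<^sup>2" for x
  proof -
    have "(cmod (a x + b x))\<^sup>2 \<le> (cmod (a x) + cmod (b x))\<^sup>2"
      by (intro power_mono norm_triangle_ineq) auto
    also have "\<dots> \<le> 2 * (cmod (a x))\<^sup>2 + 2 * (cmod (b x))\<^sup>2"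
      using sum_squares_bound[of "cmod (a x)" "cmod (b x)"] by (simp add: power2_sum)
    finally show ?thesis .
  qed
  moreover have "(\<lambda>x. (cmod (a x + b x))\<^sup>2) \<in> borel_measurable M"
    by measurable
  ultimately have "integrable M (\<lambda>x. (cmod (a x + b x))\<^sup>2)"
    by - (rule Bochner_Integration.integrable_bound[where f = "\<lambda>x. 2 * (cmod (a x))\<^sup>2 + 2 * (cmod (b x))\<^sup>2"]; simp)
  then show ?thesis by (auto simp: L2_def)
qed

lemma L2_cmult:
  assumes "a \<in> L2 M" shows "(\<lambda>x. c * a x) \<in> L2 M"
  using assms by (auto simp: L2_def norm_mult power_mult_distrib)

lemma L2_sum:
  assumes "finite F" "\<And>n. n \<in> F \<Longrightarrow> a n \<in> L2 M"
  shows "(\<lambda>x. \<Sum>n\<in>F. a n x) \<in> L2 M"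
  using assms
proof (induction F rule: finite_induct)
  case empty
  then show ?case by (simp add: L2_def)
next
  case (insert n F)
  then show ?case using L2_add[of "a n" M "\<lambda>x. \<Sum>n\<in>F. a n x"] by simp
qed

lemma has_dft_add:
  assumes e: "\<And>n. e n \<in> L2 M" and a: "has_dft M e f a" and b: "has_dft M e f' b"
  shows "has_dft M e (\<lambda>n. f n + f' n) (\<lambda>x. a x + b x)"
proof -
  define I where "I = (\<lambda>g u F. \<integral>x. (cmod (g x - (\<Sum>n\<in>F. u n * e n x)))\<^sup>2 \<partial>M)"
  have aL: "a \<in> L2 M" "b \<in> L2 M" using a b by (auto simp: has_dft_def)
  have rem: "(\<lambda>x. g x - (\<Sum>n\<in>F. u n * e n x)) \<in> L2 M" if "finite F" "g \<in> L2 M" for F g u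
    using L2_add[OF that(2) L2_cmult[OF L2_sum[OF that(1), of "\<lambda>n x. u n * e n x"], of M "-1"]]
    by (simp add: L2_cmult e)
  have le: "I (\<lambda>x. a x + b x) (\<lambda>n. f n + f' n) F \<le> 2 * I a f F + 2 * I b f' F" if "finite F" for F
  proof -
    let ?p = "\<lambda>x. a x - (\<Sum>n\<in>F. f n * e n x)" and ?q = "\<lambda>x. b x - (\<Sum>n\<in>F. f' n * e n x)"
    have int: "integrable M (\<lambda>x. (cmod (?p x))\<^sup>2)" "integrable M (\<lambda>x. (cmod (?q x))\<^sup>2)"
      using rem[OF that] aL by (auto simp: L2_def)
    have eq: "a x + b x - (\<Sum>n\<in>F. (f n + f' n) * e n x) = ?p x + ?q x" for x
      by (simp add: distrib_right sum.distrib)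
    have "I (\<lambda>x. a x + b x) (\<lambda>n. f n + f' n) F = (\<integral>x. (cmod (?p x + ?q x))\<^sup>2 \<partial>M)"
      unfolding I_def eq ..
    also have "\<dots> \<le> (\<integral>x. 2 * (cmod (?p x))\<^sup>2 + 2 * (cmod (?q x))\<^sup>2 \<partial>M)"
    proof (rule integral_mono)
      show "integrable M (\<lambda>x. (cmod (?p x + ?q x))\<^sup>2)"
        using L2_add[OF rem[OF that aL(1)] rem[OF that aL(2)]] by (auto simp: L2_def)
      show "integrable M (\<lambda>x. 2 * (cmod (?p x))\<^sup>2 + 2 * (cmod (?q x))\<^sup>2)"
        using int by auto
      show "(cmod (?p x + ?q x))\<^sup>2 \<le> 2 * (cmod (?p x))\<^sup>2 + 2 * (cmod (?q x))\<^sup>2" for x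
      proof -
        have "(cmod (?p x + ?q x))\<^sup>2 \<le> (cmod (?p x) + cmod (?q x))\<^sup>2"
          by (intro power_mono norm_triangle_ineq) auto
        also have "\<dots> \<le> 2 * (cmod (?p x))\<^sup>2 + 2 * (cmod (?q x))\<^sup>2"
          using sum_squares_bound[of "cmod (?p x)" "cmod (?q x)"] by (simp add: power2_sum)
        finally show ?thesis .
      qed
    qed
    also have "\<dots> = 2 * I a f F + 2 * I b f' F"
      using int by (simp add: I_def)
    finally show ?thesis .
  qed
  have lim: "((\<lambda>F. 2 * I a f F + 2 * I b f' F) \<longlongrightarrow> 2 * 0 + 2 * 0) (finite_subsets_at_top UNIV)"
    using a b unfolding has_dft_def I_def by (intro tendsto_intros) auto
  have "(I (\<lambda>x. a x + b x) (\<lambda>n. f n + f' n) \<longlongrightarrow> 0) (finite_subsets_at_top UNIV)"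
  proof (rule tendsto_sandwich[OF _ _ tendsto_const])
    show "\<forall>\<^sub>F F in finite_subsets_at_top UNIV. 0 \<le> I (\<lambda>x. a x + b x) (\<lambda>n. f n + f' n) F"
      by (auto simp: I_def)
    show "\<forall>\<^sub>F F in finite_subsets_at_top UNIV.
        I (\<lambda>x. a x + b x) (\<lambda>n. f n + f' n) F \<le> 2 * I a f F + 2 * I b f' F"
      by (rule eventually_finite_subsets_at_top_weakI) (rule le)
    show "((\<lambda>F. 2 * I a f F + 2 * I b f' F) \<longlongrightarrow> 0) (finite_subsets_at_top UNIV)"
      using lim by simp
  qed
  then show ?thesis
    using L2_add[OF aL] by (simp add: has_dft_def I_def)
qed

lemma has_dft_cmult:
  assumes "has_dft M e f a"
  shows "has_dft M e (\<lambda>n. c * f n) (\<lambda>x. c * a x)"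
proof -
  have eq: "c * a x - (\<Sum>n\<in>F. c * f n * e n x) = c * (a x - (\<Sum>n\<in>F. f n * e n x))" for x F
    by (simp add: sum_distrib_left right_diff_distrib mult.assoc)
  have "((\<lambda>F. (cmod c)\<^sup>2 * (\<integral>x. (cmod (a x - (\<Sum>n\<in>F. f n * e n x)))\<^sup>2 \<partial>M)) \<longlongrightarrow> (cmod c)\<^sup>2 * 0)
      (finite_subsets_at_top UNIV)"
    using assms unfolding has_dft_def by (intro tendsto_intros) auto
  then show ?thesis
    using assms unfolding has_dft_def eq
    by (simp add: norm_mult power_mult_distrib L2_cmult)
qed

lemma has_dft_shift:
  assumes "has_dft circle_measure circle_char f g"
  shows "has_dft circle_measure circle_char (\<lambda>n. f (n - s)) (\<lambda>\<theta>. cis (of_int s * \<theta>) * g \<theta>)"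
proof -
  have meas: "(\<lambda>\<theta>. cis (of_int s * \<theta>)) \<in> borel_measurable circle_measure"
    unfolding circle_measure_def
    by (intro measurable_restrict_space1) (auto intro!: borel_measurable_continuous_onI continuous_intros)
  have char: "circle_char (n + s) \<theta> = cis (of_int s * \<theta>) * circle_char n \<theta>" for n \<theta>
    by (simp add: circle_char_def cis_mult algebra_simps)
  define I where "I = (\<lambda>F. \<integral>\<theta>. (cmod (g \<theta> - (\<Sum>n\<in>F. f n * circle_char n \<theta>)))\<^sup>2 \<partial>circle_measure)"
  have eq: "(cmod (cis (of_int s * \<theta>) * g \<theta> - (\<Sum>n\<in>F. f (n - s) * circle_char n \<theta>)))\<^sup>2 =
      (cmod (g \<theta> - (\<Sum>n\<in>(\<lambda>n. n - s) ` F. f n * circle_char n \<theta>)))\<^sup>2" for F \<theta>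
  proof -
    have "(\<Sum>n\<in>F. f (n - s) * circle_char n \<theta>) =
        (\<Sum>n\<in>(\<lambda>n. n - s) ` F. f n * circle_char (n + s) \<theta>)"
      by (subst sum.reindex) (auto simp: inj_on_def)
    also have "\<dots> = cis (of_int s * \<theta>) * (\<Sum>n\<in>(\<lambda>n. n - s) ` F. f n * circle_char n \<theta>)"
      by (simp add: char sum_distrib_left mult_ac)
    finally show ?thesis
      by (simp flip: right_diff_distrib add: norm_mult)
  qed
  have filt: "filterlim ((`) (\<lambda>n::int. n - s)) (finite_subsets_at_top UNIV) (finite_subsets_at_top UNIV)"
    unfolding filterlim_iff eventually_finite_subsets_at_top
  proof (intro allI impI, elim exE conjE)
    fix P and X :: "int set"
    assume X: "finite X" "\<forall>Y. finite Y \<and> X \<subseteq> Y \<and> Y \<subseteq> UNIV \<longrightarrow> P Y"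
    have "P ((\<lambda>n. n - s) ` Y)" if Y: "finite Y" "(\<lambda>n. n + s) ` X \<subseteq> Y" for Y
    proof -
      have "X \<subseteq> (\<lambda>n. n - s) ` Y"
      proof
        fix x assume "x \<in> X"
        then have "x + s \<in> Y" using Y by auto
        then show "x \<in> (\<lambda>n. n - s) ` Y" by (rule rev_image_eqI) simp
      qed
      then show ?thesis using X Y by auto
    qed
    then show "\<exists>X. finite X \<and> X \<subseteq> UNIV \<and>
        (\<forall>Y. finite Y \<and> X \<subseteq> Y \<and> Y \<subseteq> UNIV \<longrightarrow> P ((\<lambda>n. n - s) ` Y))"
      using X(1) by (intro exI[of _ "(\<lambda>n. n + s) ` X"]) auto
  qed
  have "(I \<longlongrightarrow> 0) (finite_subsets_at_top UNIV)"
    using assms by (simp add: has_dft_def I_def)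
  then have "((\<lambda>F. I ((\<lambda>n. n - s) ` F)) \<longlongrightarrow> 0) (finite_subsets_at_top UNIV)"
    by (rule filterlim_compose) (rule filt)
  moreover have "(\<lambda>\<theta>. cis (of_int s * \<theta>) * g \<theta>) \<in> L2 circle_measure"
    using assms meas by (auto simp: has_dft_def L2_def norm_mult)
  ultimately show ?thesis
    unfolding has_dft_def eq I_def by simp
qed

lemma circle_char_L2: "circle_char n \<in> L2 circle_measure"
proof -
  have "finite_measure circle_measure"
    unfolding circle_measure_def
    by (intro finite_measureI) (simp add: emeasure_restrict_space space_restrict_space)
  then have "integrable circle_measure (\<lambda>\<theta>. (cmod (circle_char n \<theta>))\<^sup>2)"
    by (simp add: circle_char_def norm_divide finite_measure.integrable_const)
  moreover have "circle_char n \<in> borel_measurable circle_measure"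
    unfolding circle_measure_def circle_char_def
    by (intro measurable_restrict_space1) (auto intro!: borel_measurable_continuous_onI continuous_intros)
  ultimately show ?thesis by (simp add: L2_def)
qed

lemma has_dft_laplacian:
  assumes "has_dft circle_measure circle_char f g"
  shows "has_dft circle_measure circle_char (laplacian f)
           (\<lambda>\<theta>. of_real (laplacian_symbol \<theta>) * g \<theta>)"
proof -
  have symb: "of_real (laplacian_symbol \<theta>) * g \<theta> =
      2 * g \<theta> + (- 1 * (cis (of_int 1 * \<theta>) * g \<theta>) + - 1 * (cis (of_int (-1) * \<theta>) * g \<theta>))" for \<theta>
    by (simp add: laplacian_symbol_def complex_eq_iff algebra_simps)
  have lap: "laplacian f n = 2 * f n + (- 1 * f (n - 1) + - 1 * f (n - (-1)))" for n
    by (simp add: laplacian_def)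
  show ?thesis
    unfolding symb lap[abs_def]
    by (rule has_dft_add[OF circle_char_L2 has_dft_cmult[OF assms]
        has_dft_add[OF circle_char_L2 has_dft_cmult[OF has_dft_shift[OF assms]]
          has_dft_cmult[OF has_dft_shift[OF assms]]]])
qed

end

theory Submission
  imports Defs
begin

text \<open>
  The characters are complete: if all coefficients of \<open>G\<close> vanish, then by Stone--Weierstrass so do the
  integrals of \<open>G\<close> against continuous functions of the points \<open>cis (\<theta> i)\<close>, hence against Borel sets of
  such points, and \<open>cis\<close> is injective off a null set. So they form an orthonormal basis, and
  the transform identifies every operator in question with multiplication by a nonnegative function
  on its maximal domain; this includes the closed tensor operator in slot \<open>j\<close>, which becomes
  multiplication by \<open>m (\<theta> j)\<close>. Since the symbols
  \<open>m\<^sub>j \<ge> 0\<close> satisfy \<open>m\<^sub>j \<le> \<Sum>\<^sub>i m\<^sub>i\<close>, the product \<open>(\<Sum>\<^sub>j m\<^sub>j) g\<close> is square integrable iff every \<open>m\<^sub>j g\<close>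
  is. The symbols are bounded for \<open>r\<^sub>j \<ge> 0\<close>, and have a non-square-integrable singularity against
  a suitable power of \<open>\<theta>\<^sub>j\<close> for \<open>r\<^sub>j < 0\<close>.
\<close>

subsection \<open>Orthonormal systems in \<open>L\<^sup>2\<close>\<close>

text \<open>The transform and the domains are stated with functions, while a sequence fixes its
  function only almost everywhere. A sequence in the intersection thus comes with a possibly
  different function for every slot \<open>j\<close>, and it is completeness that relates these
  functions; it serves the intersection formula itself as well as the unitarity of the transform.
  Riesz-Fischer gives the other direction: every sequence in \<open>ell2\<close> comes from a
  function, so a domain can be shown to be all of \<open>ell2\<close>. The second obstacle is that
  \<open>tensor_slot\<close> is a closure, known only through limits of finite sums of elementary
  tensors. Identifying it takes two facts: multiplication by \<open>m (\<theta> j)\<close> is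
  closed, and finite sums of products approximate \<open>g\<close> and \<open>m g\<close> at the
  same time. Both come from the factor \<open>1 / (1 + m)\<close>, which is bounded, stays bounded
  after multiplication by \<open>m\<close>, and depends on the single coordinate
  \<open>\<theta> j\<close>, so that it turns a character into another product of one-variable
  functions.\<close>

lemma norm_add_sq_le: "(norm (a + b))\<^sup>2 \<le> 2 * (norm a)\<^sup>2 + 2 * (norm b)\<^sup>2"
  for a b :: "'a::real_normed_vector"
proof -
  have "(norm (a + b))\<^sup>2 \<le> (norm a + norm b)\<^sup>2"
    by (intro power_mono norm_triangle_ineq) auto
  also have "\<dots> \<le> 2 * (norm a)\<^sup>2 + 2 * (norm b)\<^sup>2"
    using sum_squares_bound[of "norm a" "norm b"] by (simp add: power2_sum)
  finally show ?thesis .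
qed

lemma L2_diff: "a \<in> L2 M \<Longrightarrow> b \<in> L2 M \<Longrightarrow> (\<lambda>x. a x - b x) \<in> L2 M"
  using L2_add[of a M "\<lambda>x. - 1 * b x"] L2_cmult[of b M "-1"] by simp

lemma L2_mult_bounded:
  fixes b :: "'x \<Rightarrow> real"
  assumes g: "g \<in> L2 M" and [measurable]: "b \<in> borel_measurable M"
    and C: "\<And>x. x \<in> space M \<Longrightarrow> \<bar>b x\<bar> \<le> C"
  shows "(\<lambda>x. of_real (b x) * g x) \<in> L2 M"
proof -
  have [measurable]: "g \<in> borel_measurable M" and i: "integrable M (\<lambda>x. (cmod (g x))\<^sup>2)"
    using g by (auto simp: L2_def)
  have "integrable M (\<lambda>x. (cmod (of_real (b x) * g x))\<^sup>2)"
  proof (rule Bochner_Integration.integrable_bound)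
    show "integrable M (\<lambda>x. C\<^sup>2 * (cmod (g x))\<^sup>2)" using i by simp
    show "AE x in M. norm ((cmod (of_real (b x) * g x))\<^sup>2) \<le> norm (C\<^sup>2 * (cmod (g x))\<^sup>2)"
    proof (rule AE_I2)
      fix x assume "x \<in> space M"
      then have "(b x)\<^sup>2 \<le> C\<^sup>2"
        using C[of x] by (subst power2_le_iff_abs_le) (auto intro: order_trans[OF abs_ge_zero])
      then show "norm ((cmod (of_real (b x) * g x))\<^sup>2) \<le> norm (C\<^sup>2 * (cmod (g x))\<^sup>2)"
        by (simp add: norm_mult power_mult_distrib mult_right_mono)
    qed
  qed simp
  then show ?thesis by (simp add: L2_def)
qed

lemma L2_cong_AE:
  assumes "a \<in> L2 M" "b \<in> borel_measurable M" "AE x in M. a x = b x"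
  shows "b \<in> L2 M"
proof -
  have "integrable M (\<lambda>x. (cmod (b x))\<^sup>2) \<longleftrightarrow> integrable M (\<lambda>x. (cmod (a x))\<^sup>2)"
    using assms by (intro integrable_cong_AE) (auto simp: L2_def)
  then show ?thesis using assms by (simp add: L2_def)
qed

lemma L2_integrable_mult_cnj:
  assumes "a \<in> L2 M" "b \<in> L2 M"
  shows "integrable M (\<lambda>x. a x * cnj (b x))"
proof (rule Bochner_Integration.integrable_bound)
  have [measurable]: "a \<in> borel_measurable M" "b \<in> borel_measurable M"
    using assms by (auto simp: L2_def)
  show "integrable M (\<lambda>x. (cmod (a x))\<^sup>2 + (cmod (b x))\<^sup>2)"
    using assms by (auto simp: L2_def)
  have "cmod u * cmod v \<le> (cmod u)\<^sup>2 + (cmod v)\<^sup>2" for u v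
    using sum_squares_bound[of "cmod u" "cmod v"] mult_nonneg_nonneg[OF norm_ge_zero[of u] norm_ge_zero[of v]]
    by linarith
  then show "AE x in M. norm (a x * cnj (b x)) \<le> norm ((cmod (a x))\<^sup>2 + (cmod (b x))\<^sup>2)"
    by (intro AE_I2) (auto simp: norm_mult)
  show "(\<lambda>x. a x * cnj (b x)) \<in> borel_measurable M"
    using borel_measurable_continuous_on[OF continuous_on_cnj[OF continuous_on_id] \<open>b \<in> borel_measurable M\<close>]
    by simp
qed

text \<open>The square is kept instead of the norm: it is the integral in \<open>has_dft\<close>,
  and the factor 2 in \<open>sqnorm_add_le\<close> is a sufficient substitute for the triangle
  inequality.\<close>

definition sqnorm :: "'x measure \<Rightarrow> ('x \<Rightarrow> complex) \<Rightarrow> real" where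
  "sqnorm M g = (\<integral>x. (cmod (g x))\<^sup>2 \<partial>M)"

text \<open>The inverse transform: for an orthonormal basis, \<open>has_dft M e f g\<close> will
  amount to \<open>f = coef M e g\<close> with \<open>g\<close> in \<open>L2 M\<close>.\<close>

definition coef :: "'x measure \<Rightarrow> ('n \<Rightarrow> 'x \<Rightarrow> complex) \<Rightarrow> ('x \<Rightarrow> complex) \<Rightarrow> 'n \<Rightarrow> complex" where
  "coef M e g n = (\<integral>x. g x * cnj (e n x) \<partial>M)"

lemma sqnorm_nonneg: "0 \<le> sqnorm M g"
  by (simp add: sqnorm_def)

lemma sqnorm_eq_0_iff: "g \<in> L2 M \<Longrightarrow> sqnorm M g = 0 \<longleftrightarrow> (AE x in M. g x = 0)"
  unfolding sqnorm_def by (subst integral_nonneg_eq_0_iff_AE) (auto simp: L2_def)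

lemma sqnorm_cong_AE:
  assumes "AE x in M. a x = b x" "a \<in> borel_measurable M" "b \<in> borel_measurable M"
  shows "sqnorm M a = sqnorm M b"
  unfolding sqnorm_def using assms by (intro integral_cong_AE) auto

lemma sqnorm_mono:
  assumes "a \<in> L2 M" "b \<in> L2 M" "\<And>x. x \<in> space M \<Longrightarrow> cmod (a x) \<le> cmod (b x)"
  shows "sqnorm M a \<le> sqnorm M b"
  unfolding sqnorm_def using assms by (intro integral_mono) (auto simp: L2_def intro!: power_mono)

lemma sqnorm_add_le:
  assumes "a \<in> L2 M" "b \<in> L2 M"
  shows "sqnorm M (\<lambda>x. a x + b x) \<le> 2 * sqnorm M a + 2 * sqnorm M b"
proof -
  have i: "integrable M (\<lambda>x. (cmod (a x))\<^sup>2)" "integrable M (\<lambda>x. (cmod (b x))\<^sup>2)"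
    "integrable M (\<lambda>x. (cmod (a x + b x))\<^sup>2)"
    using assms L2_add[OF assms] by (auto simp: L2_def)
  have "sqnorm M (\<lambda>x. a x + b x) \<le> (\<integral>x. 2 * (cmod (a x))\<^sup>2 + 2 * (cmod (b x))\<^sup>2 \<partial>M)"
    unfolding sqnorm_def using i by (intro integral_mono norm_add_sq_le) auto
  also have "\<dots> = 2 * sqnorm M a + 2 * sqnorm M b"
    using i by (simp add: sqnorm_def)
  finally show ?thesis .
qed

lemma has_dft_iff_sqnorm:
  "has_dft M e f g \<longleftrightarrow> g \<in> L2 M \<and>
     ((\<lambda>F. sqnorm M (\<lambda>x. g x - (\<Sum>n\<in>F. f n * e n x))) \<longlongrightarrow> 0) (finite_subsets_at_top UNIV)"
  by (simp add: has_dft_def sqnorm_def)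

lemma coef_diff:
  assumes "a \<in> L2 M" "b \<in> L2 M" "e n \<in> L2 M"
  shows "coef M e (\<lambda>x. a x - b x) n = coef M e a n - coef M e b n"
  unfolding coef_def left_diff_distrib using assms
  by (intro Bochner_Integration.integral_diff L2_integrable_mult_cnj)

lemma coef_sum:
  assumes "\<And>i. i \<in> I \<Longrightarrow> a i \<in> L2 M" "e n \<in> L2 M"
  shows "coef M e (\<lambda>x. \<Sum>i\<in>I. a i x) n = (\<Sum>i\<in>I. coef M e (a i) n)"
  unfolding coef_def sum_distrib_right using assms
  by (intro Bochner_Integration.integral_sum L2_integrable_mult_cnj)

lemma coef_cmult: "coef M e (\<lambda>x. c * a x) n = c * coef M e a n"
  by (simp add: coef_def mult.assoc)

lemma coef_cong_AE:
  assumes "AE x in M. a x = b x" "a \<in> L2 M" "b \<in> L2 M" "\<And>n. e n \<in> L2 M"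
  shows "coef M e a = coef M e b"
proof
  fix n
  have "(\<lambda>x. a x * cnj (e n x)) \<in> borel_measurable M" "(\<lambda>x. b x * cnj (e n x)) \<in> borel_measurable M"
    using L2_integrable_mult_cnj assms by (metis borel_measurable_integrable)+
  then show "coef M e a n = coef M e b n"
    unfolding coef_def using assms by (intro integral_cong_AE) auto
qed

text \<open>Orthonormality without totality: the level at which Bessel, Parseval and Riesz-Fischer
  live.\<close>

locale ortho_system =
  fixes M :: "'x measure" and e :: "'n \<Rightarrow> 'x \<Rightarrow> complex"
  assumes e_L2: "e n \<in> L2 M"
    and ortho: "coef M e (e m) n = (if m = n then 1 else 0)"
begin

lemma partial_sum_L2: "finite F \<Longrightarrow> (\<lambda>x. \<Sum>n\<in>F. f n * e n x) \<in> L2 M"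
  by (intro L2_sum L2_cmult e_L2)

lemma coef_partial_sum:
  assumes "finite F"
  shows "coef M e (\<lambda>x. \<Sum>n\<in>F. f n * e n x) m = (if m \<in> F then f m else 0)"
  using assms by (subst coef_sum) (auto intro!: L2_cmult e_L2 simp: coef_cmult ortho if_distrib cong: if_cong)

text \<open>Completing the square in the coefficients. As \<open>f\<close> is arbitrary, one
  identity serves three purposes: \<open>f = coef M e g\<close> gives Bessel, \<open>g = 0\<close>
  gives Pythagoras, and the last sum forces the coefficients of a convergent expansion.\<close>

lemma sqnorm_diff_partial_sum:
  assumes F: "finite F" and g: "g \<in> L2 M"
  shows "sqnorm M (\<lambda>x. g x - (\<Sum>n\<in>F. f n * e n x)) =
    sqnorm M g - (\<Sum>n\<in>F. (cmod (coef M e g n))\<^sup>2) + (\<Sum>n\<in>F. (cmod (f n - coef M e g n))\<^sup>2)"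
proof -
  define S where "S = (\<lambda>x. \<Sum>n\<in>F. f n * e n x)"
  have S: "S \<in> L2 M" unfolding S_def by (rule partial_sum_L2[OF F])
  have gg: "integrable M (\<lambda>x. (cmod (g x))\<^sup>2)" using g by (simp add: L2_def)
  have i: "integrable M (\<lambda>x. h x * cnj (f n * e n x))" if "h \<in> L2 M" for h n
    using L2_integrable_mult_cnj[OF that L2_cmult[OF e_L2]] by blast
  have inner: "(\<integral>x. h x * cnj (S x) \<partial>M) = (\<Sum>n\<in>F. cnj (f n) * coef M e h n)"
    and iS: "integrable M (\<lambda>x. h x * cnj (S x))" if h: "h \<in> L2 M" for h
  proof -
    have "(\<integral>x. h x * cnj (S x) \<partial>M) = (\<integral>x. (\<Sum>n\<in>F. h x * cnj (f n * e n x)) \<partial>M)"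
      by (simp add: S_def sum_distrib_left)
    also have "\<dots> = (\<Sum>n\<in>F. \<integral>x. h x * cnj (f n * e n x) \<partial>M)"
      by (intro Bochner_Integration.integral_sum i h)
    also have "\<dots> = (\<Sum>n\<in>F. \<integral>x. cnj (f n) * (h x * cnj (e n x)) \<partial>M)"
      by (intro sum.cong Bochner_Integration.integral_cong) (auto simp: mult_ac)
    finally show "(\<integral>x. h x * cnj (S x) \<partial>M) = (\<Sum>n\<in>F. cnj (f n) * coef M e h n)"
      by (simp add: coef_def)
    show "integrable M (\<lambda>x. h x * cnj (S x))" by (rule L2_integrable_mult_cnj[OF h S])
  qed
  \<comment> \<open>The expansion is carried out in the complex numbers, where the mixed terms are
    the integrals computed in \<open>inner\<close>; at the end \<open>of_real\<close> is
    cancelled.\<close>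
  have expand: "complex_of_real ((cmod (g x - S x))\<^sup>2) =
      of_real ((cmod (g x))\<^sup>2) - g x * cnj (S x) - cnj (g x * cnj (S x)) + S x * cnj (S x)" for x
    unfolding complex_norm_square by (simp add: algebra_simps)
  have "complex_of_real (sqnorm M (\<lambda>x. g x - S x)) = (\<integral>x. complex_of_real ((cmod (g x - S x))\<^sup>2) \<partial>M)"
    unfolding sqnorm_def by (rule integral_complex_of_real[symmetric])
  also have "\<dots> = of_real (sqnorm M g) - (\<integral>x. g x * cnj (S x) \<partial>M) - cnj (\<integral>x. g x * cnj (S x) \<partial>M)
      + (\<integral>x. S x * cnj (S x) \<partial>M)"
  proof -
    have "integrable M (\<lambda>x. complex_of_real ((cmod (g x))\<^sup>2))" "integrable M (\<lambda>x. cnj (g x * cnj (S x)))"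
      using gg iS[OF g] by (auto simp del: complex_cnj_mult of_real_power)
    then show ?thesis
      unfolding expand sqnorm_def integral_complex_of_real[symmetric]
      using iS[OF g] iS[OF S]
      by (simp only: Bochner_Integration.integral_diff Bochner_Integration.integral_add
          Bochner_Integration.integrable_diff Bochner_Integration.integral_cnj)
  qed
  also have "\<dots> = of_real (sqnorm M g) - (\<Sum>n\<in>F. cnj (f n) * coef M e g n)
      - cnj (\<Sum>n\<in>F. cnj (f n) * coef M e g n) + (\<Sum>n\<in>F. cnj (f n) * f n)"
    unfolding inner[OF g] inner[OF S] using F
    by (simp add: S_def coef_partial_sum cong: sum.cong)
  also have "\<dots> = of_real (sqnorm M g) + (\<Sum>n\<in>F. - (cnj (f n) * coef M e g n)
      - f n * cnj (coef M e g n) + cnj (f n) * f n)"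
    by (simp add: sum.distrib sum_subtractf sum_negf)
  also have "(\<Sum>n\<in>F. - (cnj (f n) * coef M e g n) - f n * cnj (coef M e g n) + cnj (f n) * f n)
      = (\<Sum>n\<in>F. of_real ((cmod (f n - coef M e g n))\<^sup>2 - (cmod (coef M e g n))\<^sup>2))"
    by (intro sum.cong refl) (simp only: of_real_diff complex_norm_square, simp add: algebra_simps)
  finally have "complex_of_real (sqnorm M (\<lambda>x. g x - S x)) = of_real (sqnorm M g
      + (\<Sum>n\<in>F. (cmod (f n - coef M e g n))\<^sup>2 - (cmod (coef M e g n))\<^sup>2))"
    by simp
  then show ?thesis unfolding S_def of_real_eq_iff by (simp add: sum_subtractf)
qed

lemma Bessel:
  assumes "finite F" "g \<in> L2 M"
  shows "(\<Sum>n\<in>F. (cmod (coef M e g n))\<^sup>2) \<le> sqnorm M g"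
  using sqnorm_diff_partial_sum[OF assms, of "coef M e g"]
    sqnorm_nonneg[of M "\<lambda>x. g x - (\<Sum>n\<in>F. coef M e g n * e n x)"] by simp

lemma coef_ell2:
  assumes "g \<in> L2 M" shows "coef M e g \<in> ell2"
  unfolding ell2_def mem_Collect_eq
  by (rule nonneg_bdd_above_summable_on) (auto intro!: bdd_aboveI[of _ "sqnorm M g"] Bessel assms)

text \<open>As soon as \<open>n\<close> lies in \<open>F\<close>, the error of the partial sum is at
  least the squared difference of the two coefficients at \<open>n\<close>, by the identity above
  and Bessel; the error tends to 0.\<close>

lemma has_dft_coef:
  assumes "has_dft M e f g"
  shows "f = coef M e g"
proof
  fix n
  let ?I = "\<lambda>F. sqnorm M (\<lambda>x. g x - (\<Sum>n\<in>F. f n * e n x))"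
  have g: "g \<in> L2 M" and lim: "(?I \<longlongrightarrow> 0) (finite_subsets_at_top UNIV)"
    using assms by (auto simp: has_dft_iff_sqnorm)
  have "(cmod (f n - coef M e g n))\<^sup>2 \<le> 0"
  proof (rule tendsto_lowerbound[OF lim])
    show "\<forall>\<^sub>F F in finite_subsets_at_top UNIV. (cmod (f n - coef M e g n))\<^sup>2 \<le> ?I F"
      unfolding eventually_finite_subsets_at_top
    proof (intro exI[of _ "{n}"] conjI allI impI; (elim conjE)?)
      fix F assume F: "finite F" "{n} \<subseteq> F"
      have "(cmod (f n - coef M e g n))\<^sup>2 \<le> (\<Sum>n\<in>F. (cmod (f n - coef M e g n))\<^sup>2)"
        using F by (intro member_le_sum) auto
      then show "(cmod (f n - coef M e g n))\<^sup>2 \<le> ?I F"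
        using Bessel[OF F(1) g] unfolding sqnorm_diff_partial_sum[OF F(1) g] by simp
    qed auto
  qed simp
  then show "f n = coef M e g n" by simp
qed

text \<open>With the right coefficients the error equals \<open>sqnorm M g\<close> minus the partial
  sum of squares.\<close>

lemma Parseval:
  assumes "has_dft M e f g"
  shows "(\<Sum>\<^sub>\<infinity>n. (cmod (f n))\<^sup>2) = sqnorm M g"
proof -
  have f: "f = coef M e g" by (rule has_dft_coef[OF assms])
  have g: "g \<in> L2 M" and lim: "((\<lambda>F. sqnorm M (\<lambda>x. g x - (\<Sum>n\<in>F. f n * e n x))) \<longlongrightarrow> 0)
      (finite_subsets_at_top UNIV)"
    using assms by (auto simp: has_dft_iff_sqnorm)
  have "((\<lambda>F. sqnorm M g - sqnorm M (\<lambda>x. g x - (\<Sum>n\<in>F. f n * e n x))) \<longlongrightarrow> sqnorm M g)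
      (finite_subsets_at_top UNIV)"
    using tendsto_diff[OF tendsto_const lim] by simp
  then have "((\<lambda>F. \<Sum>n\<in>F. (cmod (f n))\<^sup>2) \<longlongrightarrow> sqnorm M g) (finite_subsets_at_top UNIV)"
  proof (rule Lim_transform_eventually)
    show "\<forall>\<^sub>F F in finite_subsets_at_top UNIV.
      sqnorm M g - sqnorm M (\<lambda>x. g x - (\<Sum>n\<in>F. f n * e n x)) = (\<Sum>n\<in>F. (cmod (f n))\<^sup>2)"
      by (rule eventually_finite_subsets_at_top_weakI)
        (use sqnorm_diff_partial_sum[OF _ g, of _ f] f in simp)
  qed
  then show ?thesis
    by (intro infsumI) (simp add: has_sum_def)
qed

lemma sqnorm_partial_sum:
  assumes F: "finite F"
  shows "sqnorm M (\<lambda>x. \<Sum>n\<in>F. f n * e n x) = (\<Sum>n\<in>F. (cmod (f n))\<^sup>2)"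
  using sqnorm_diff_partial_sum[OF F, of "\<lambda>_. 0" "f"]
  by (simp add: coef_def sqnorm_def L2_def)

lemma sqnorm_diff_partial_sums_le:
  assumes F: "finite F" "finite G"
  shows "sqnorm M (\<lambda>x. (\<Sum>n\<in>F. f n * e n x) - (\<Sum>n\<in>G. f n * e n x))
    \<le> (\<Sum>n\<in>F - G. (cmod (f n))\<^sup>2) + (\<Sum>n\<in>G - F. (cmod (f n))\<^sup>2)"
proof -
  \<comment> \<open>The sign puts both differences into one expansion: common indices cancel, and
    Pythagoras applies on the symmetric difference.\<close>
  define h where "h = (\<lambda>n. if n \<in> F then f n else - f n)"
  have "(\<Sum>n\<in>F. f n * e n x) - (\<Sum>n\<in>G. f n * e n x) = (\<Sum>n\<in>(F - G) \<union> (G - F). h n * e n x)" for x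
  proof -
    have "(\<Sum>n\<in>F. f n * e n x) = (\<Sum>n\<in>F - G. f n * e n x) + (\<Sum>n\<in>F \<inter> G. f n * e n x)"
      using sum.Int_Diff[OF F(1), of _ G] by (simp add: add.commute)
    moreover have "(\<Sum>n\<in>G. f n * e n x) = (\<Sum>n\<in>G - F. f n * e n x) + (\<Sum>n\<in>F \<inter> G. f n * e n x)"
      using sum.Int_Diff[OF F(2), of _ F] by (simp add: add.commute Int_commute)
    moreover have "(\<Sum>n\<in>(F - G) \<union> (G - F). h n * e n x) = (\<Sum>n\<in>F - G. h n * e n x) + (\<Sum>n\<in>G - F. h n * e n x)"
      using F by (intro sum.union_disjoint) auto
    ultimately show ?thesis by (simp add: h_def sum_negf)
  qed
  then have "sqnorm M (\<lambda>x. (\<Sum>n\<in>F. f n * e n x) - (\<Sum>n\<in>G. f n * e n x))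
      = (\<Sum>n\<in>(F - G) \<union> (G - F). (cmod (h n))\<^sup>2)"
    using F by (simp add: sqnorm_partial_sum)
  also have "\<dots> = (\<Sum>n\<in>F - G. (cmod (h n))\<^sup>2) + (\<Sum>n\<in>G - F. (cmod (h n))\<^sup>2)"
    using F by (intro sum.union_disjoint) auto
  finally show ?thesis by (simp add: h_def)
qed

text \<open>Along a sequence of finite sets with tails below \<open>4\<^sup>-\<^sup>k\<close>, the increments \<open>D k\<close> of the partial
  sums satisfy \<open>\<bar>D k\<bar> \<le> 2\<^sup>-\<^sup>k + 2\<^sup>k \<bar>D k\<bar>\<^sup>2\<close>, which is a.e. summable, so the partial sums converge
  pointwise a.e.; Fatou's lemma identifies the limit in \<open>L\<^sup>2\<close>.\<close>

theorem Riesz_Fischer: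
  assumes f: "f \<in> ell2"
  obtains g where "has_dft M e f g"
proof -
  define a where "a = (\<lambda>n. (cmod (f n))\<^sup>2)"
  define s where "s = infsum a UNIV"
  define S where "S = (\<lambda>F x. \<Sum>n\<in>F. f n * e n x)"
  have summ: "a summable_on UNIV" using f by (simp add: ell2_def a_def)
  have a0: "0 \<le> a n" for n by (simp add: a_def)
  have le: "sum a F \<le> s" if "finite F" for F
    unfolding s_def using that by (intro finite_sum_le_infsum summ) (auto simp: a0)
  have lim: "(sum a \<longlongrightarrow> s) (finite_subsets_at_top UNIV)"
    unfolding s_def by (rule infsum_tendsto[OF summ])
  have "\<exists>F. finite F \<and> s - sum a F < (1/4)^k" for k
  proof -
    have "\<forall>\<^sub>F F in finite_subsets_at_top UNIV. s - (1/4)^k < sum a F"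
      by (rule order_tendstoD[OF lim]) simp
    then obtain F where "finite F" "s - (1/4)^k < sum a F"
      unfolding eventually_finite_subsets_at_top by blast
    then show ?thesis by (intro exI[of _ F]) simp
  qed
  then obtain F where F: "\<And>k. finite (F k)" "\<And>k. s - sum a (F k) < (1/4)^k"
    by metis
  have tail: "sum a (G - F k) \<le> (1/4)^k" if "finite G" for G k
  proof -
    have "sum a (F k \<union> (G - F k)) = sum a (F k) + sum a (G - F k)"
      using that F by (intro sum.union_disjoint) auto
    then show ?thesis using le[of "F k \<union> (G - F k)"] F that by (smt (verit) finite_Diff finite_UnI)
  qed
  have SL: "S G \<in> L2 M" if "finite G" for G
    unfolding S_def by (rule partial_sum_L2[OF that])
  have Sm[measurable]: "S (F k) \<in> borel_measurable M" for k
    using SL[OF F(1)] by (simp add: L2_def)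
  define D where "D = (\<lambda>k x. S (F (Suc k)) x - S (F k) x)"
  have DL: "D k \<in> L2 M" for k
    unfolding D_def by (intro L2_diff SL F)
  have Dm[measurable]: "D k \<in> borel_measurable M" for k
    using DL by (simp add: L2_def)
  \<comment> \<open>The sets \<open>F k\<close> need not be nested, so both set differences occur;
    each is a tail past one of the two sets.\<close>
  have sqD: "sqnorm M (D k) \<le> 2 * (1/4)^k" for k
  proof -
    have "sqnorm M (D k) \<le> sum a (F (Suc k) - F k) + sum a (F k - F (Suc k))"
      unfolding D_def S_def a_def by (rule sqnorm_diff_partial_sums_le[OF F(1) F(1)])
    also have "\<dots> \<le> (1/4)^k + (1/4)^Suc k"
      by (intro add_mono tail F)
    also have "\<dots> \<le> 2 * (1/4)^k" by simp
    finally show ?thesis .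
  qed
  define w where "w = (\<lambda>k x. 2^k * (cmod (D k x))\<^sup>2)"
  have wm[measurable]: "w k \<in> borel_measurable M" for k
    unfolding w_def by measurable
  have w: "(\<integral>\<^sup>+x. ennreal (w k x) \<partial>M) \<le> ennreal (2 * (1/2)^k)" for k
  proof -
    have "(\<integral>\<^sup>+x. ennreal (w k x) \<partial>M) = ennreal (\<integral>x. w k x \<partial>M)"
      using DL[of k] by (intro nn_integral_eq_integral) (auto simp: w_def L2_def)
    also have "(\<integral>x. w k x \<partial>M) = 2^k * sqnorm M (D k)"
      by (simp add: w_def sqnorm_def)
    also have "ennreal \<dots> \<le> ennreal (2^k * (2 * (1/4)^k))"
      using sqD by (intro ennreal_leI mult_left_mono) auto
    also have "(2::real)^k * (2 * (1/4)^k) = 2 * (1/2)^k"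
      by (simp add: power_divide field_simps flip: power_mult_distrib)
    finally show ?thesis .
  qed
  have "(\<integral>\<^sup>+x. (\<Sum>k. ennreal (w k x)) \<partial>M) = (\<Sum>k. \<integral>\<^sup>+x. ennreal (w k x) \<partial>M)"
    by (intro nn_integral_suminf) auto
  also have "\<dots> \<le> (\<Sum>k. ennreal (2 * (1/2)^k))"
    by (intro suminf_le w) auto
  also have "\<dots> = ennreal (\<Sum>k. 2 * (1/2)^k)"
    by (intro suminf_ennreal2) (auto intro!: summable_mult summable_geometric)
  also have "\<dots> < \<infinity>" by simp
  finally have "AE x in M. (\<Sum>k. ennreal (w k x)) \<noteq> \<infinity>"
    by (intro nn_integral_PInf_AE) auto
  then have conv: "AE x in M. convergent (\<lambda>k. S (F k) x)"
  proof eventually_elim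
    case (elim x)
    have "summable (\<lambda>k. w k x)"
      by (rule summable_suminf_not_top) (use elim in \<open>auto simp: w_def\<close>)
    then have "summable (\<lambda>k. (1/2)^k + w k x)"
      by (intro summable_add summable_geometric) auto
    then have "summable (\<lambda>k. D k x)"
    proof (rule summable_comparison_test'[where N = 0])
      fix k
      define c t where "c = (2::real)^k" and "t = norm (D k x)"
      have c: "0 < c" by (simp add: c_def)
      have "0 \<le> c * t" using c by (simp add: t_def)
      then have "c * t \<le> 1 + (c * t)\<^sup>2"
        using sum_squares_bound[of "c * t" 1] by simp
      then have "t \<le> (1 + (c * t)\<^sup>2) / c"
        using c by (simp add: pos_le_divide_eq mult.commute)
      also have "\<dots> = 1 / c + c * t\<^sup>2"
        using c by (simp add: field_simps power2_eq_square)
      finally show "norm (D k x) \<le> (1/2)^k + w k x"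
        by (simp add: w_def c_def t_def power_divide)
    qed
    then have "convergent (\<lambda>k. \<Sum>i<k. D i x)"
      by (simp add: summable_iff_convergent)
    then have "convergent (\<lambda>k. S (F 0) x + (\<Sum>i<k. D i x))"
      by (intro convergent_add convergent_const)
    moreover have "S (F 0) x + (\<Sum>i<k. D i x) = S (F k) x" for k
      unfolding D_def by (subst sum_lessThan_telescope[of "\<lambda>k. S (F k) x"]) simp
    ultimately show ?case by simp
  qed
  define g where "g = (\<lambda>x. lim (\<lambda>k. S (F k) x))"
  have gm[measurable]: "g \<in> borel_measurable M" unfolding g_def by measurable
  have glim: "AE x in M. (\<lambda>k. S (F k) x) \<longlonglongrightarrow> g x"
    using conv by eventually_elim (simp add: g_def convergent_LIMSEQ_iff)
  \<comment> \<open>Fatou's lemma bounds the error for an arbitrary finite \<open>G\<close>, not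
    only for the chosen \<open>F k\<close>: this is what the unconditional convergence in
    \<open>has_dft\<close> asks for, and \<open>G = {}\<close> gives square integrability of
    \<open>g\<close>.\<close>
  have nn: "(\<integral>\<^sup>+x. ennreal ((cmod (g x - S G x))\<^sup>2) \<partial>M) \<le> ennreal (s - sum a G)" if G: "finite G" for G
  proof -
    have [measurable]: "S G \<in> borel_measurable M" using SL[OF G] by (simp add: L2_def)
    have "(\<integral>\<^sup>+x. ennreal ((cmod (g x - S G x))\<^sup>2) \<partial>M)
        = (\<integral>\<^sup>+x. liminf (\<lambda>k. ennreal ((cmod (S (F k) x - S G x))\<^sup>2)) \<partial>M)"
    proof (rule nn_integral_cong_AE)
      show "AE x in M. ennreal ((cmod (g x - S G x))\<^sup>2) = liminf (\<lambda>k. ennreal ((cmod (S (F k) x - S G x))\<^sup>2))"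
        using glim
      proof eventually_elim
        case (elim x)
        then have "(\<lambda>k. ennreal ((cmod (S (F k) x - S G x))\<^sup>2)) \<longlonglongrightarrow> ennreal ((cmod (g x - S G x))\<^sup>2)"
          by (intro tendsto_ennrealI tendsto_intros)
        then show ?case by (intro lim_imp_Liminf[symmetric]) auto
      qed
    qed
    also have "\<dots> \<le> liminf (\<lambda>k. \<integral>\<^sup>+x. ennreal ((cmod (S (F k) x - S G x))\<^sup>2) \<partial>M)"
      by (intro nn_integral_liminf) auto
    also have "\<dots> \<le> liminf (\<lambda>k. ennreal (s - sum a G + (1/4)^k))"
    proof (intro Liminf_mono always_eventually allI)
      fix k
      have "sum a (G \<union> (F k - G)) = sum a G + sum a (F k - G)"
        using G F by (intro sum.union_disjoint) auto
      then have 1: "sum a (F k - G) \<le> s - sum a G"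
        using le[of "G \<union> (F k - G)"] G F by simp
      have "(\<integral>\<^sup>+x. ennreal ((cmod (S (F k) x - S G x))\<^sup>2) \<partial>M) = ennreal (sqnorm M (\<lambda>x. S (F k) x - S G x))"
        unfolding sqnorm_def using L2_diff[OF SL[OF F(1)] SL[OF G]]
        by (intro nn_integral_eq_integral) (auto simp: L2_def)
      also have "\<dots> \<le> ennreal (sum a (F k - G) + sum a (G - F k))"
        unfolding S_def a_def by (intro ennreal_leI sqnorm_diff_partial_sums_le F G)
      also have "\<dots> \<le> ennreal (s - sum a G + (1/4)^k)"
        by (intro ennreal_leI add_mono 1 tail G)
      finally show "(\<integral>\<^sup>+x. ennreal ((cmod (S (F k) x - S G x))\<^sup>2) \<partial>M) \<le> ennreal (s - sum a G + (1/4)^k)" .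
    qed
    also have "\<dots> = ennreal (s - sum a G)"
    proof (rule lim_imp_Liminf)
      have "(\<lambda>k. s - sum a G + (1/4)^k) \<longlonglongrightarrow> s - sum a G + 0"
        by (intro tendsto_intros LIMSEQ_power_zero) simp
      then show "(\<lambda>k. ennreal (s - sum a G + (1/4)^k)) \<longlonglongrightarrow> ennreal (s - sum a G)"
        by (intro tendsto_ennrealI) simp
    qed simp
    finally show ?thesis .
  qed
  have gL: "g \<in> L2 M"
  proof -
    have "integrable M (\<lambda>x. (cmod (g x))\<^sup>2)"
      by (rule integrableI_nonneg) (use nn[of "{}"] in \<open>auto simp: S_def intro: le_less_trans\<close>)
    then show ?thesis by (simp add: L2_def)
  qed
  have sq: "sqnorm M (\<lambda>x. g x - S G x) \<le> s - sum a G" if G: "finite G" for G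
  proof -
    have "ennreal (sqnorm M (\<lambda>x. g x - S G x)) \<le> ennreal (s - sum a G)"
      using nn[OF G] L2_diff[OF gL SL[OF G]] unfolding sqnorm_def
      by (subst nn_integral_eq_integral[symmetric]) (auto simp: L2_def)
    then show ?thesis using le[OF G] by (simp add: ennreal_le_iff)
  qed
  have "((\<lambda>G. sqnorm M (\<lambda>x. g x - S G x)) \<longlongrightarrow> 0) (finite_subsets_at_top UNIV)"
  proof (rule tendsto_sandwich[OF _ _ tendsto_const])
    show "\<forall>\<^sub>F G in finite_subsets_at_top UNIV. 0 \<le> sqnorm M (\<lambda>x. g x - S G x)"
      by (simp add: sqnorm_nonneg)
    show "\<forall>\<^sub>F G in finite_subsets_at_top UNIV. sqnorm M (\<lambda>x. g x - S G x) \<le> s - sum a G"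
      by (rule eventually_finite_subsets_at_top_weakI) (rule sq)
    show "((\<lambda>G. s - sum a G) \<longlongrightarrow> 0) (finite_subsets_at_top UNIV)"
      using tendsto_diff[OF tendsto_const lim, of s] by simp
  qed
  then have "has_dft M e f g"
    using gL by (simp add: has_dft_iff_sqnorm S_def)
  then show ?thesis by (rule that)
qed

end

section \<open>Orthonormal bases: the transform as a unitary map\<close>

locale ortho_basis = ortho_system +
  assumes total: "g \<in> L2 M \<Longrightarrow> (\<And>n. coef M e g n = 0) \<Longrightarrow> AE x in M. g x = 0"
begin

lemma coef_eq_iff_AE:
  assumes "g \<in> L2 M" "h \<in> L2 M"
  shows "coef M e g = coef M e h \<longleftrightarrow> (AE x in M. g x = h x)"
proof
  assume "coef M e g = coef M e h"
  then have "AE x in M. g x - h x = 0"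
    by (intro total L2_diff assms) (simp add: coef_diff assms e_L2)
  then show "AE x in M. g x = h x" by simp
qed (intro coef_cong_AE assms e_L2)

text \<open>The coefficients of \<open>g\<close> lie in \<open>ell2\<close>, so Riesz-Fischer gives
  an expansion of some \<open>h\<close> with the same coefficients; by totality \<open>h = g\<close>
  almost everywhere, and the convergence carries over to \<open>g\<close>.\<close>

lemma has_dft_iff: "has_dft M e f g \<longleftrightarrow> g \<in> L2 M \<and> f = coef M e g"
proof
  assume "has_dft M e f g"
  then show "g \<in> L2 M \<and> f = coef M e g"
    using has_dft_coef by (auto simp: has_dft_def)
next
  assume *: "g \<in> L2 M \<and> f = coef M e g"
  then have g: "g \<in> L2 M" and "f \<in> ell2" using coef_ell2 by auto
  then obtain h where h: "has_dft M e f h" using Riesz_Fischer by blast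
  then have hL: "h \<in> L2 M" and lim: "((\<lambda>F. sqnorm M (\<lambda>x. h x - (\<Sum>n\<in>F. f n * e n x))) \<longlongrightarrow> 0)
      (finite_subsets_at_top UNIV)"
    by (auto simp: has_dft_iff_sqnorm)
  have ae: "AE x in M. h x = g x"
    using * has_dft_coef[OF h] coef_eq_iff_AE[OF hL g] by simp
  have "((\<lambda>F. sqnorm M (\<lambda>x. g x - (\<Sum>n\<in>F. f n * e n x))) \<longlongrightarrow> 0) (finite_subsets_at_top UNIV)"
  proof (rule Lim_transform_eventually[OF lim eventually_finite_subsets_at_top_weakI])
    fix F :: "'b set" assume "finite F"
    then have "(\<lambda>x. \<Sum>n\<in>F. f n * e n x) \<in> L2 M" by (rule partial_sum_L2)
    then have "(\<lambda>x. h x - (\<Sum>n\<in>F. f n * e n x)) \<in> L2 M" "(\<lambda>x. g x - (\<Sum>n\<in>F. f n * e n x)) \<in> L2 M"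
      using hL g L2_diff by blast+
    then show "sqnorm M (\<lambda>x. h x - (\<Sum>n\<in>F. f n * e n x)) = sqnorm M (\<lambda>x. g x - (\<Sum>n\<in>F. f n * e n x))"
      using ae by (intro sqnorm_cong_AE) (auto simp: L2_def)
  qed
  then show "has_dft M e f g" using g by (simp add: has_dft_iff_sqnorm)
qed

lemma ell2_eq_coef_image: "ell2 = coef M e ` L2 M"
proof (intro set_eqI iffI)
  fix f :: "'b \<Rightarrow> complex" assume "f \<in> ell2"
  then obtain g where "has_dft M e f g" by (rule Riesz_Fischer)
  then show "f \<in> coef M e ` L2 M" unfolding has_dft_iff by blast
qed (use coef_ell2 in blast)

lemma ell2_norm_coef: "g \<in> L2 M \<Longrightarrow> ell2_norm (coef M e g) = sqrt (sqnorm M g)"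
  unfolding ell2_norm_def by (subst Parseval) (auto simp: has_dft_iff)

lemma ell2_norm_coef_diff:
  assumes "g \<in> L2 M" "h \<in> L2 M"
  shows "ell2_norm (\<lambda>n. coef M e g n - coef M e h n) = sqrt (sqnorm M (\<lambda>x. g x - h x))"
proof -
  have "coef M e (\<lambda>x. g x - h x) = (\<lambda>n. coef M e g n - coef M e h n)"
    by (intro ext coef_diff assms e_L2)
  then show ?thesis using ell2_norm_coef[OF L2_diff[OF assms]] by simp
qed

text \<open>The function \<open>g\<close> stays existentially quantified, because \<open>f\<close>
  determines it only up to a null set. Membership of \<open>f\<close> and \<open>h\<close> in
  \<open>ell2\<close> follows from Bessel.\<close>

lemma fourier_multiplier_iff:
  "(f, h) \<in> fourier_multiplier M e m \<longleftrightarrow>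
    (\<exists>g\<in>L2 M. (\<lambda>x. of_real (m x) * g x) \<in> L2 M \<and> f = coef M e g \<and>
      h = coef M e (\<lambda>x. of_real (m x) * g x))"
  unfolding fourier_multiplier_def mult_op_def has_dft_iff using coef_ell2 by auto

lemma Domain_fourier_multiplier:
  "Domain (fourier_multiplier M e m) = coef M e ` {g \<in> L2 M. (\<lambda>x. of_real (m x) * g x) \<in> L2 M}"
proof (intro set_eqI iffI)
  fix f assume "f \<in> Domain (fourier_multiplier M e m)"
  then obtain h where "(f, h) \<in> fourier_multiplier M e m" by blast
  then show "f \<in> coef M e ` {g \<in> L2 M. (\<lambda>x. of_real (m x) * g x) \<in> L2 M}"
    unfolding fourier_multiplier_iff by blast
next
  fix f assume "f \<in> coef M e ` {g \<in> L2 M. (\<lambda>x. of_real (m x) * g x) \<in> L2 M}"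
  then obtain g where g: "g \<in> L2 M" "(\<lambda>x. of_real (m x) * g x) \<in> L2 M" "f = coef M e g"
    by blast
  then have "(f, coef M e (\<lambda>x. of_real (m x) * g x)) \<in> fourier_multiplier M e m"
    unfolding fourier_multiplier_iff by (intro bexI[of _ g]) simp_all
  then show "f \<in> Domain (fourier_multiplier M e m)" by (rule DomainI)
qed

end

subsection \<open>The torus\<close>

lemma space_circle_measure [simp]: "space circle_measure = {-pi..pi}"
  by (simp add: circle_measure_def space_restrict_space)

interpretation circle: finite_measure circle_measure
  by (intro finite_measureI)
    (simp add: emeasure_restrict_space space_restrict_space circle_measure_def)

lemma measurable_circle_measureI: "f \<in> borel_measurable borel \<Longrightarrow> f \<in> borel_measurable circle_measure"
  unfolding circle_measure_def by (simp add: measurable_restrict_space1)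

lemma circle_char_measurable [measurable]: "circle_char n \<in> borel_measurable circle_measure"
  using circle_char_L2 by (simp add: L2_def)

lemma integral_circle_char:
  "(\<integral>\<theta>. circle_char m \<theta> * cnj (circle_char n \<theta>) \<partial>circle_measure) = (if m = n then 1 else 0)"
proof -
  define k where "k = real_of_int (m - n)"
  have mult: "circle_char m \<theta> * cnj (circle_char n \<theta>) = cis (k * \<theta>) / of_real (2 * pi)" for \<theta>
  proof -
    have "circle_char m \<theta> * cnj (circle_char n \<theta>) =
      cis (of_int m * \<theta>) * cis (- (of_int n * \<theta>)) / of_real (sqrt (2 * pi) * sqrt (2 * pi))"
      by (simp add: circle_char_def cis_cnj flip: of_real_mult)
    also have "cis (of_int m * \<theta>) * cis (- (of_int n * \<theta>)) = cis (k * \<theta>)"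
      by (simp add: cis_mult k_def algebra_simps)
    finally show ?thesis by simp
  qed
  have "(\<integral>\<theta>. circle_char m \<theta> * cnj (circle_char n \<theta>) \<partial>circle_measure)
      = (\<integral>\<theta>. indicator {-pi..pi} \<theta> *\<^sub>R (cis (k * \<theta>) / of_real (2 * pi)) \<partial>lborel)"
    unfolding mult circle_measure_def by (subst integral_restrict_space) auto
  also have "\<dots> = (if m = n then 1 else 0)"
  proof (cases "m = n")
    case True
    then have "k = 0" by (simp add: k_def)
    then show ?thesis using True by (simp add: scaleR_conv_of_real flip: of_real_mult of_real_divide)
  next
    case False
    then have k: "k \<noteq> 0" by (simp add: k_def)
    define F where "F = (\<lambda>\<theta>. cis (k * \<theta>) / (\<i> * of_real k * of_real (2 * pi)))"
    have "(\<integral>\<theta>. indicator {-pi..pi} \<theta> *\<^sub>R (cis (k * \<theta>) / of_real (2 * pi)) \<partial>lborel) = F pi - F (- pi)"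
    proof (rule integral_FTC_atLeastAtMost)
      show "(F has_vector_derivative cis (k * \<theta>) / of_real (2 * pi)) (at \<theta> within {-pi..pi})" for \<theta>
        unfolding F_def has_vector_derivative_def using k
        by (auto intro!: derivative_eq_intros simp: scaleR_conv_of_real field_simps)
    qed (auto intro!: continuous_intros)
    also have "sin (pi * k) = 0" unfolding k_def by (rule sin_npi_int)
    then have "cis (k * pi) = cis (k * - pi)"
      by (simp add: complex_eq_iff mult.commute[of k])
    then have "F pi - F (- pi) = 0" by (simp add: F_def)
    finally show ?thesis using False by simp
  qed
  finally show ?thesis .
qed

section \<open>Product functions on the torus\<close>

interpretation circle_prod: product_sigma_finite "\<lambda>_. circle_measure"
  by standard

lemma space_torus_measure [simp]: "space torus_measure = {\<theta>. \<forall>i. \<theta> i \<in> {-pi..pi}}"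
  by (auto simp: torus_measure_def space_PiM)

interpretation torus: finite_measure "torus_measure :: ('d::finite \<Rightarrow> real) measure"
proof (rule finite_measureI)
  have "emeasure (torus_measure :: ('d \<Rightarrow> real) measure) (Pi\<^sub>E UNIV (\<lambda>_. space circle_measure))
      = (\<Prod>i\<in>(UNIV :: 'd set). emeasure circle_measure (space circle_measure))"
    unfolding torus_measure_def by (rule circle_prod.emeasure_PiM) (auto simp del: space_circle_measure)
  then show "emeasure (torus_measure :: ('d \<Rightarrow> real) measure) (space torus_measure) \<noteq> \<infinity>"
    unfolding torus_measure_def space_PiM
    by (simp add: power_eq_top_ennreal del: space_circle_measure)
qed

lemma torus_measurable_component [measurable]: "(\<lambda>\<theta>. \<theta> i) \<in> measurable torus_measure circle_measure"
  unfolding torus_measure_def by (rule measurable_component_singleton) simp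

lemma torus_measurable_slot:
  "f \<in> borel_measurable circle_measure \<Longrightarrow> (\<lambda>\<theta>. f (\<theta> i)) \<in> borel_measurable torus_measure"
  by (rule measurable_compose[OF torus_measurable_component])

lemma torus_integral_prod:
  fixes f :: "'d::finite \<Rightarrow> real \<Rightarrow> 'b::{real_normed_field,banach,second_countable_topology}"
  assumes "\<And>i. integrable circle_measure (f i)"
  shows "integrable torus_measure (\<lambda>\<theta>. \<Prod>i\<in>UNIV. f i (\<theta> i))"
    and "(\<integral>\<theta>. (\<Prod>i\<in>UNIV. f i (\<theta> i)) \<partial>torus_measure) = (\<Prod>i\<in>UNIV. \<integral>\<theta>. f i \<theta> \<partial>circle_measure)"
  unfolding torus_measure_def
  using circle_prod.product_integrable_prod[of "UNIV :: 'd set" f] circle_prod.product_integral_prod[of "UNIV :: 'd set" f]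
    assms by auto

lemma L2_torus_prod:
  assumes "\<And>i. g i \<in> L2 circle_measure"
  shows "(\<lambda>\<theta>. \<Prod>i\<in>UNIV. g i (\<theta> i)) \<in> L2 torus_measure"
    and "sqnorm torus_measure (\<lambda>\<theta>. \<Prod>i\<in>UNIV. g i (\<theta> i)) = (\<Prod>i\<in>UNIV. sqnorm circle_measure (g i))"
proof -
  have eq: "(cmod (\<Prod>i\<in>UNIV. g i (\<theta> i)))\<^sup>2 = (\<Prod>i\<in>UNIV. (cmod (g i (\<theta> i)))\<^sup>2)" for \<theta>
    by (simp add: prod_norm[symmetric] prod_power_distrib)
  have i: "integrable circle_measure (\<lambda>\<theta>. (cmod (g i \<theta>))\<^sup>2)" for i
    using assms by (simp add: L2_def)
  have "(\<lambda>\<theta>. \<Prod>i\<in>UNIV. g i (\<theta> i)) \<in> borel_measurable torus_measure"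
    using assms by (intro borel_measurable_prod torus_measurable_slot) (auto simp: L2_def)
  then show "(\<lambda>\<theta>. \<Prod>i\<in>UNIV. g i (\<theta> i)) \<in> L2 torus_measure"
    using torus_integral_prod(1)[OF i] by (simp add: L2_def eq)
  show "sqnorm torus_measure (\<lambda>\<theta>. \<Prod>i\<in>UNIV. g i (\<theta> i)) = (\<Prod>i\<in>UNIV. sqnorm circle_measure (g i))"
    unfolding sqnorm_def eq by (rule torus_integral_prod(2)[OF i])
qed

text \<open>By Fubini the integral of a product of one-variable functions factors. This is the
  bridge to \<open>tensor\<close>: the coefficients of a product function form an elementary
  tensor.\<close>

lemma coef_torus_prod:
  assumes "\<And>i. g i \<in> L2 circle_measure"
  shows "coef torus_measure torus_char (\<lambda>\<theta>. \<Prod>i\<in>UNIV. g i (\<theta> i)) n =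
    (\<Prod>i\<in>UNIV. coef circle_measure circle_char (g i) (n i))"
  unfolding coef_def torus_char_def cnj_prod prod.distrib[symmetric]
  by (rule torus_integral_prod(2)) (intro L2_integrable_mult_cnj assms circle_char_L2)

lemma torus_char_L2: "torus_char n \<in> L2 torus_measure"
  using L2_torus_prod(1)[of "\<lambda>i. circle_char (n i)", OF circle_char_L2] by (simp add: torus_char_def[abs_def])

lemma coef_torus_char: "coef torus_measure torus_char (torus_char m) n = (if m = n then 1 else 0)"
proof -
  have "coef torus_measure torus_char (torus_char m) n =
    (\<Prod>i\<in>UNIV. coef circle_measure circle_char (circle_char (m i)) (n i))"
    using coef_torus_prod[of "\<lambda>i. circle_char (m i)", OF circle_char_L2]
    by (simp add: torus_char_def[abs_def])
  also have "\<dots> = (\<Prod>i\<in>UNIV. if m i = n i then 1 else 0)"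
    by (simp add: coef_def integral_circle_char)
  also have "\<dots> = (if m = n then 1 else 0)"
    by (auto simp: fun_eq_iff intro!: prod_zero)
  finally show ?thesis .
qed

section \<open>Trigonometric polynomials\<close>

lemma torus_char_eq:
  "torus_char n \<theta> = (\<Prod>i\<in>UNIV. cis (of_int (n i) * \<theta> i)) / of_real (sqrt (2 * pi)) ^ CARD('d)"
  for n :: "'d::finite \<Rightarrow> int"
  by (simp add: torus_char_def circle_char_def prod_dividef)

text \<open>The normalisation leaves a constant, so products of characters are characters only up to
  scalars; \<open>trig_poly\<close> admits scalar factors and absorbs it.\<close>

lemma torus_char_mult:
  "torus_char m \<theta> * torus_char n \<theta> = torus_char (\<lambda>i. m i + n i) \<theta> / of_real (sqrt (2 * pi)) ^ CARD('d)"
  for n :: "'d::finite \<Rightarrow> int"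
  by (simp add: torus_char_eq prod.distrib[symmetric] cis_mult distrib_right)

lemma torus_char_single:
  "torus_char ((\<lambda>_. 0)(i := k)) \<theta> = cis (of_int k * \<theta> i) / of_real (sqrt (2 * pi)) ^ CARD('d)"
  for i :: "'d::finite"
proof -
  have "(\<Prod>i'\<in>UNIV. cis (of_int (((\<lambda>_. 0)(i := k)) i') * \<theta> i')) =
      (\<Prod>i'\<in>UNIV. if i' = i then cis (of_int k * \<theta> i) else 1)"
    by (intro prod.cong) auto
  then show ?thesis by (simp add: torus_char_eq)
qed

lemma cnj_torus_char: "cnj (torus_char n \<theta>) = torus_char (\<lambda>i. - n i) \<theta>"
  by (simp add: torus_char_eq cis_cnj)

text \<open>Generated linearly, so that vanishing of integrals against \<open>G\<close> is an easy
  induction; closure under products, which makes it an algebra, is derived in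
  \<open>trig_poly_mult\<close>.\<close>

inductive_set trig_poly :: "(('d::finite \<Rightarrow> real) \<Rightarrow> complex) set" where
  char: "(\<lambda>\<theta>. c * torus_char n \<theta>) \<in> trig_poly"
| add: "p \<in> trig_poly \<Longrightarrow> q \<in> trig_poly \<Longrightarrow> (\<lambda>\<theta>. p \<theta> + q \<theta>) \<in> trig_poly"

lemma trig_poly_single: "(\<lambda>\<theta>. c * cis (of_int k * \<theta> i)) \<in> trig_poly"
proof -
  have "(\<lambda>\<theta>. c * cis (of_int k * \<theta> i)) =
      (\<lambda>\<theta>. (c * of_real (sqrt (2 * pi)) ^ CARD('a)) * torus_char ((\<lambda>_. 0)(i := k)) \<theta>)"
    by (simp add: torus_char_single)
  then show ?thesis by (simp only: trig_poly.char)
qed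

lemma trig_poly_const: "(\<lambda>_. c) \<in> trig_poly"
  using trig_poly_single[of c 0] by simp

lemma trig_poly_mult:
  assumes "p \<in> trig_poly" "q \<in> trig_poly"
  shows "(\<lambda>\<theta>. p \<theta> * q \<theta>) \<in> trig_poly"
  using assms(1)
proof induction
  case (char c n)
  show ?case using assms(2)
  proof induction
    case (char d m)
    have "(\<lambda>\<theta>. c * torus_char n \<theta> * (d * torus_char m \<theta>)) =
      (\<lambda>\<theta>. (c * d / of_real (sqrt (2 * pi)) ^ CARD('a)) * torus_char (\<lambda>i. n i + m i) \<theta>)"
    proof
      fix \<theta> :: "'a \<Rightarrow> real"
      have "c * torus_char n \<theta> * (d * torus_char m \<theta>) = c * d * (torus_char n \<theta> * torus_char m \<theta>)"
        by (simp add: mult_ac)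
      then show "c * torus_char n \<theta> * (d * torus_char m \<theta>) =
        (c * d / of_real (sqrt (2 * pi)) ^ CARD('a)) * torus_char (\<lambda>i. n i + m i) \<theta>"
        by (simp add: torus_char_mult)
    qed
    then show ?case by (simp only: trig_poly.char)
  next
    case (add p q)
    then show ?case unfolding distrib_left by (intro trig_poly.add)
  qed
next
  case (add p q)
  then show ?case unfolding distrib_right by (intro trig_poly.add)
qed

text \<open>\<open>coef\<close> integrates against conjugates. The conjugate of a character is the
  character of the negated index, so vanishing coefficients also kill the integrals against the
  characters themselves.\<close>

lemma integral_trig_poly_eq_0:
  assumes G: "G \<in> L2 torus_measure" and coef: "\<And>n. coef torus_measure torus_char G n = 0"
    and p: "p \<in> trig_poly"
  shows "integrable torus_measure (\<lambda>\<theta>. G \<theta> * p \<theta>) \<and> (\<integral>\<theta>. G \<theta> * p \<theta> \<partial>torus_measure) = 0"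
  using p
proof induction
  case (char c n)
  have "(\<lambda>\<theta>. G \<theta> * (c * torus_char n \<theta>)) = (\<lambda>\<theta>. c * (G \<theta> * cnj (torus_char (\<lambda>i. - n i) \<theta>)))"
    by (simp add: cnj_torus_char mult_ac)
  then show ?case
    using L2_integrable_mult_cnj[OF G torus_char_L2] coef[of "\<lambda>i. - n i"] by (simp add: coef_def)
qed (simp add: distrib_left)

text \<open>Characters do not distinguish the coordinate values \<open>- pi\<close> and
  \<open>pi\<close>, hence do not separate the points of the cube. Stone-Weierstrass is therefore
  applied on the product of circles, to which \<open>torus_point\<close> carries the cube.\<close>

definition torus_point :: "('d::finite \<Rightarrow> real) \<Rightarrow> 'd \<Rightarrow> complex" where
  "torus_point \<theta> = (\<lambda>i. cis (\<theta> i))"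

definition complex_torus :: "('d::finite \<Rightarrow> complex) set" where
  "complex_torus = Pi\<^sub>E UNIV (\<lambda>_. sphere 0 1)"

lemma compact_complex_torus: "compact (complex_torus :: ('d::finite \<Rightarrow> complex) set)"
proof -
  have "compactin (product_topology (\<lambda>_. euclidean) UNIV) (complex_torus :: ('d \<Rightarrow> complex) set)"
    unfolding complex_torus_def compactin_PiE by simp
  then show ?thesis by (simp add: euclidean_product_topology)
qed

lemma torus_point_in [simp]: "torus_point \<theta> \<in> complex_torus"
  by (auto simp: torus_point_def complex_torus_def PiE_def)

lemma torus_point_measurable [measurable]: "torus_point \<in> measurable torus_measure borel"
  unfolding torus_point_def
  by (intro measurable_coordinatewise_then_product torus_measurable_slot measurable_circle_measureI
      borel_measurable_continuous_onI continuous_intros)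

lemma torus_Stone_Weierstrass:
  fixes \<phi> :: "('d::finite \<Rightarrow> complex) \<Rightarrow> real"
  assumes \<phi>: "continuous_on UNIV \<phi>" and \<epsilon>: "0 < \<epsilon>"
  obtains p where "p \<in> trig_poly" "\<And>\<theta>. cmod (of_real (\<phi> (torus_point \<theta>)) - p \<theta>) < \<epsilon>"
proof -
  \<comment> \<open>A ring of real functions, as the real form of Stone-Weierstrass requires. The
    complex structure enters only through \<open>Re\<close> and \<open>Im\<close> of the
    coordinates, which separate points and pull back to trigonometric polynomials by Euler's
    formulas.\<close>
  define R where "R = {h :: ('d \<Rightarrow> complex) \<Rightarrow> real. continuous_on complex_torus h \<and>
    (\<lambda>\<theta>. of_real (h (torus_point \<theta>))) \<in> trig_poly}"
  have coord: "continuous_on complex_torus (\<lambda>z :: 'd \<Rightarrow> complex. z i)" for i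
    by (rule continuous_on_subset[OF continuous_on_product_coordinates]) simp
  have Re: "(\<lambda>z. Re (z i)) \<in> R" for i
  proof -
    have "(\<lambda>\<theta>::'d \<Rightarrow> real. complex_of_real (Re (torus_point \<theta> i))) =
      (\<lambda>\<theta>. (1/2) * cis (of_int 1 * \<theta> i) + (1/2) * cis (of_int (- 1) * \<theta> i))"
      by (simp add: fun_eq_iff torus_point_def complex_eq_iff)
    then show ?thesis
      unfolding R_def mem_Collect_eq
      by (simp only:) (intro conjI continuous_intros coord trig_poly.add trig_poly_single)
  qed
  have Im: "(\<lambda>z. Im (z i)) \<in> R" for i
  proof -
    have "(\<lambda>\<theta>::'d \<Rightarrow> real. complex_of_real (Im (torus_point \<theta> i))) =
      (\<lambda>\<theta>. (-\<i>/2) * cis (of_int 1 * \<theta> i) + (\<i>/2) * cis (of_int (- 1) * \<theta> i))"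
      by (simp add: fun_eq_iff torus_point_def complex_eq_iff)
    then show ?thesis
      unfolding R_def mem_Collect_eq
      by (simp only:) (intro conjI continuous_intros coord trig_poly.add trig_poly_single)
  qed
  interpret function_ring_on R complex_torus
  proof
    show "compact (complex_torus :: ('d \<Rightarrow> complex) set)" by (rule compact_complex_torus)
  next
    fix z w :: "'d \<Rightarrow> complex" assume "z \<noteq> w"
    then obtain i where "z i \<noteq> w i" by auto
    then have "Re (z i) \<noteq> Re (w i) \<or> Im (z i) \<noteq> Im (w i)" by (simp add: complex_eq_iff)
    then show "\<exists>h\<in>R. h z \<noteq> h w" using bexI[OF _ Re[of i]] bexI[OF _ Im[of i]] by meson
  qed (auto simp: R_def intro!: continuous_intros trig_poly.add trig_poly_mult trig_poly_const)
  obtain h where h: "h \<in> R" "\<And>z. z \<in> complex_torus \<Longrightarrow> \<bar>\<phi> z - h z\<bar> < \<epsilon>"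
    using Stone_Weierstrass_basic[OF continuous_on_subset[OF \<phi>] \<epsilon>] by auto
  show ?thesis
  proof (rule that)
    show "(\<lambda>\<theta>. of_real (h (torus_point \<theta>))) \<in> trig_poly" using h by (simp add: R_def)
    show "cmod (of_real (\<phi> (torus_point \<theta>)) - of_real (h (torus_point \<theta>))) < \<epsilon>" for \<theta>
      using h(2)[OF torus_point_in, of \<theta>] by (simp flip: of_real_diff)
  qed
qed

section \<open>Totality of the characters\<close>

lemma L2_torus_integrable:
  assumes "G \<in> L2 torus_measure"
  shows "integrable torus_measure G"
proof -
  have "(\<lambda>_. 1) \<in> L2 torus_measure" by (simp add: L2_def)
  then show ?thesis using L2_integrable_mult_cnj[OF assms] by fastforce
qed

text \<open>If a trigonometric polynomial \<open>p\<close> is uniformly within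
  \<open>\<epsilon>\<close> of \<open>\<phi>\<close>, the integral against \<open>p\<close>
  vanishes, so the one against \<open>\<phi>\<close> is at most \<open>\<epsilon>\<close> times the
  integral of \<open>cmod (G \<theta>)\<close>.\<close>

lemma torus_integral_continuous_eq_0:
  fixes \<phi> :: "('d::finite \<Rightarrow> complex) \<Rightarrow> real"
  assumes G: "G \<in> L2 torus_measure" and coef: "\<And>n. coef torus_measure torus_char G n = 0"
    and \<phi>: "continuous_on UNIV \<phi>"
  shows "(\<integral>\<theta>. \<phi> (torus_point \<theta>) *\<^sub>R G \<theta> \<partial>torus_measure) = 0"
proof -
  have iG: "integrable torus_measure G" by (rule L2_torus_integrable[OF G])
  have [measurable]: "G \<in> borel_measurable torus_measure" using iG by simp
  have [measurable]: "\<phi> \<in> borel_measurable borel" by (rule borel_measurable_continuous_onI[OF \<phi>])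
  have "bounded (\<phi> ` complex_torus)"
    by (intro compact_imp_bounded compact_continuous_image compact_complex_torus continuous_on_subset[OF \<phi>]) simp
  then obtain B where B: "\<And>z. z \<in> complex_torus \<Longrightarrow> \<bar>\<phi> z\<bar> \<le> B"
    unfolding bounded_iff by auto
  have i\<phi>: "integrable torus_measure (\<lambda>\<theta>. \<phi> (torus_point \<theta>) *\<^sub>R G \<theta>)"
  proof (rule Bochner_Integration.integrable_bound)
    show "integrable torus_measure (\<lambda>\<theta>. B * cmod (G \<theta>))" using iG by simp
    show "AE \<theta> in torus_measure. norm (\<phi> (torus_point \<theta>) *\<^sub>R G \<theta>) \<le> norm (B * cmod (G \<theta>))"
      using B[OF torus_point_in] by (intro AE_I2) (auto simp: abs_mult intro!: mult_right_mono order_trans[OF _ abs_ge_self])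
  qed simp
  define I where "I = (\<integral>\<theta>. cmod (G \<theta>) \<partial>torus_measure)"
  have "cmod (\<integral>\<theta>. \<phi> (torus_point \<theta>) *\<^sub>R G \<theta> \<partial>torus_measure) \<le> \<epsilon> * I" if \<epsilon>: "0 < \<epsilon>" for \<epsilon>
  proof -
    obtain p where p: "p \<in> trig_poly" "\<And>\<theta>. cmod (of_real (\<phi> (torus_point \<theta>)) - p \<theta>) < \<epsilon>"
      using torus_Stone_Weierstrass[OF \<phi> \<epsilon>] by blast
    have ip: "integrable torus_measure (\<lambda>\<theta>. G \<theta> * p \<theta>)"
      and p0: "(\<integral>\<theta>. G \<theta> * p \<theta> \<partial>torus_measure) = 0"
      using integral_trig_poly_eq_0[OF G coef p(1)] by auto
    have "(\<integral>\<theta>. \<phi> (torus_point \<theta>) *\<^sub>R G \<theta> \<partial>torus_measure) =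
      (\<integral>\<theta>. \<phi> (torus_point \<theta>) *\<^sub>R G \<theta> - G \<theta> * p \<theta> \<partial>torus_measure)"
      using i\<phi> ip p0 by simp
    also have "cmod \<dots> \<le> (\<integral>\<theta>. cmod (\<phi> (torus_point \<theta>) *\<^sub>R G \<theta> - G \<theta> * p \<theta>) \<partial>torus_measure)"
      by (rule integral_norm_bound)
    also have "\<dots> \<le> (\<integral>\<theta>. \<epsilon> * cmod (G \<theta>) \<partial>torus_measure)"
    proof (rule integral_mono)
      show "integrable torus_measure (\<lambda>\<theta>. cmod (\<phi> (torus_point \<theta>) *\<^sub>R G \<theta> - G \<theta> * p \<theta>))"
        using i\<phi> ip by simp
      show "integrable torus_measure (\<lambda>\<theta>. \<epsilon> * cmod (G \<theta>))" using iG by simp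
      show "cmod (\<phi> (torus_point \<theta>) *\<^sub>R G \<theta> - G \<theta> * p \<theta>) \<le> \<epsilon> * cmod (G \<theta>)" for \<theta>
      proof -
        have "\<phi> (torus_point \<theta>) *\<^sub>R G \<theta> - G \<theta> * p \<theta> = (of_real (\<phi> (torus_point \<theta>)) - p \<theta>) * G \<theta>"
          by (simp add: scaleR_conv_of_real algebra_simps)
        then show ?thesis
          using p(2)[of \<theta>] by (simp add: norm_mult mult_right_mono)
      qed
    qed
    also have "\<dots> = \<epsilon> * I" by (simp add: I_def)
    finally show ?thesis .
  qed
  then have "\<forall>\<^sub>F \<epsilon> in at_right 0. cmod (\<integral>\<theta>. \<phi> (torus_point \<theta>) *\<^sub>R G \<theta> \<partial>torus_measure) \<le> \<epsilon> * I"
    by (auto intro!: eventually_at_rightI[of 0 1])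
  moreover have "((\<lambda>\<epsilon>. \<epsilon> * I) \<longlongrightarrow> 0 * I) (at_right 0)"
    by (intro tendsto_intros)
  ultimately have "cmod (\<integral>\<theta>. \<phi> (torus_point \<theta>) *\<^sub>R G \<theta> \<partial>torus_measure) \<le> 0 * I"
    by (intro tendsto_lowerbound[where F = "at_right (0::real)"]) auto
  then show ?thesis by simp
qed

lemma torus_integral_closed_eq_0:
  fixes C :: "('d::finite \<Rightarrow> complex) set"
  assumes G: "G \<in> L2 torus_measure" and coef: "\<And>n. coef torus_measure torus_char G n = 0"
    and C: "closed C"
  shows "(\<integral>\<theta>. indicator C (torus_point \<theta>) *\<^sub>R G \<theta> \<partial>torus_measure) = 0"
\<comment> \<open>For \<open>C = {}\<close> the value \<open>infdist z C\<close> is 0 everywhere,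
  and the approximation below would be constantly 1.\<close>
proof (cases "C = {}")
  case False
  have iG: "integrable torus_measure G" by (rule L2_torus_integrable[OF G])
  have [measurable]: "G \<in> borel_measurable torus_measure" using iG by simp
  \<comment> \<open>Continuous, with values between 0 and 1, equal to 1 on \<open>C\<close>, and 0
    for large \<open>k\<close> at each point off the closed set \<open>C\<close>.\<close>
  define \<phi> where "\<phi> = (\<lambda>k z. max 0 (1 - real k * infdist z C))"
  have cont: "continuous_on UNIV (\<phi> k)" for k
    unfolding \<phi>_def by (intro continuous_intros)
  have [measurable]: "\<phi> k \<in> borel_measurable borel" for k
    by (rule borel_measurable_continuous_onI[OF cont])
  have [measurable]: "C \<in> sets borel" using C by simp
  have lim: "(\<lambda>k. \<phi> k z) \<longlonglongrightarrow> indicator C z" for z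
  proof (cases "z \<in> C")
    case True
    then show ?thesis by (simp add: \<phi>_def)
  next
    case z: False
    then have pos: "0 < infdist z C"
      using in_closed_iff_infdist_zero[OF C False, of z] infdist_nonneg[of z C] by linarith
    obtain N where N: "1 < real N * infdist z C"
      using reals_Archimedean3[OF pos] by blast
    have "\<forall>\<^sub>F k in sequentially. \<phi> k z = 0"
      using eventually_ge_at_top[of N]
    proof eventually_elim
      case (elim k)
      then have "real N * infdist z C \<le> real k * infdist z C"
        using pos by (intro mult_right_mono) auto
      then show ?case using N by (simp add: \<phi>_def)
    qed
    then show ?thesis using z by (simp add: tendsto_eventually)
  qed
  have "(\<lambda>k. \<integral>\<theta>. \<phi> k (torus_point \<theta>) *\<^sub>R G \<theta> \<partial>torus_measure) \<longlonglongrightarrow>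
    (\<integral>\<theta>. indicator C (torus_point \<theta>) *\<^sub>R G \<theta> \<partial>torus_measure)"
  proof (rule integral_dominated_convergence[where w = "\<lambda>\<theta>. cmod (G \<theta>)"])
    show "AE \<theta> in torus_measure. (\<lambda>k. \<phi> k (torus_point \<theta>) *\<^sub>R G \<theta>) \<longlonglongrightarrow>
        indicator C (torus_point \<theta>) *\<^sub>R G \<theta>"
      by (intro AE_I2 tendsto_intros lim)
    show "AE \<theta> in torus_measure. norm (\<phi> k (torus_point \<theta>) *\<^sub>R G \<theta>) \<le> cmod (G \<theta>)" for k
    proof (rule AE_I2)
      fix \<theta>
      have "\<bar>\<phi> k (torus_point \<theta>)\<bar> \<le> 1"
        by (simp add: \<phi>_def infdist_nonneg)
      then show "norm (\<phi> k (torus_point \<theta>) *\<^sub>R G \<theta>) \<le> cmod (G \<theta>)"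
        using mult_right_mono[of "\<bar>\<phi> k (torus_point \<theta>)\<bar>" 1 "cmod (G \<theta>)"] by simp
    qed
  qed (use iG in auto)
  then have "(\<lambda>k. 0) \<longlonglongrightarrow> (\<integral>\<theta>. indicator C (torus_point \<theta>) *\<^sub>R G \<theta> \<partial>torus_measure)"
    by (simp add: torus_integral_continuous_eq_0[OF G coef cont])
  then show ?thesis by (simp add: LIMSEQ_const_iff)
qed simp

text \<open>Dynkin's argument: the sets with vanishing integral include the closed sets, an
  intersection-stable generator, and are stable under complements and disjoint unions. The
  complement step uses that \<open>G\<close> itself has integral 0, which is the closed case
  \<open>UNIV\<close>.\<close>

lemma torus_integral_borel_eq_0:
  fixes B :: "('d::finite \<Rightarrow> complex) set"
  assumes G: "G \<in> L2 torus_measure" and coef: "\<And>n. coef torus_measure torus_char G n = 0"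
    and B: "B \<in> sets borel"
  shows "(\<integral>\<theta>. indicator B (torus_point \<theta>) *\<^sub>R G \<theta> \<partial>torus_measure) = 0"
proof -
  have iG: "integrable torus_measure G" by (rule L2_torus_integrable[OF G])
  have [measurable]: "G \<in> borel_measurable torus_measure" using iG by simp
  have i: "integrable torus_measure (\<lambda>\<theta>. indicator A (torus_point \<theta>) *\<^sub>R G \<theta>)"
    if [measurable]: "A \<in> sets borel" for A :: "('d \<Rightarrow> complex) set"
    by (rule Bochner_Integration.integrable_bound[OF iG]) (auto simp: indicator_def)
  have sb: "sigma_sets UNIV (Collect closed) = sets (borel :: ('d \<Rightarrow> complex) measure)"
    by (simp add: borel_eq_closed)
  have "Int_stable (Collect closed :: ('d \<Rightarrow> complex) set set)" "Collect closed \<subseteq> Pow (UNIV :: ('d \<Rightarrow> complex) set)"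
    "B \<in> sigma_sets UNIV (Collect closed)"
    using B sb by (auto simp: Int_stable_def)
  then show ?thesis
  proof (induction rule: sigma_sets_induct_disjoint)
    case (basic A)
    then show ?case by (intro torus_integral_closed_eq_0 G coef) simp
  next
    case empty
    show ?case by simp
  next
    case (compl A)
    then have [measurable]: "A \<in> sets borel" using sb by simp
    have "(\<integral>\<theta>. G \<theta> \<partial>torus_measure) = 0"
      using torus_integral_closed_eq_0[OF G coef closed_UNIV] by simp
    moreover have "indicator (UNIV - A) (torus_point \<theta>) *\<^sub>R G \<theta> =
      G \<theta> - indicator A (torus_point \<theta>) *\<^sub>R G \<theta>" for \<theta>
      by (simp add: indicator_def)
    ultimately show ?case using compl iG i[of A] by simp
  next
    case (union A)
    then have A[measurable]: "A k \<in> sets borel" for k using sb by auto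
    have sums: "(\<lambda>k. indicator (A k) z :: real) sums indicator (\<Union>k. A k) z" for z
      by (rule indicator_sums) (use union in \<open>auto simp: disjoint_family_on_def\<close>)
    have "(\<lambda>m. \<integral>\<theta>. (\<Sum>k<m. indicator (A k) (torus_point \<theta>)) *\<^sub>R G \<theta> \<partial>torus_measure) \<longlonglongrightarrow>
      (\<integral>\<theta>. indicator (\<Union>k. A k) (torus_point \<theta>) *\<^sub>R G \<theta> \<partial>torus_measure)"
    proof (rule integral_dominated_convergence[where w = "\<lambda>\<theta>. cmod (G \<theta>)"])
      show "AE \<theta> in torus_measure. (\<lambda>m. (\<Sum>k<m. indicator (A k) (torus_point \<theta>)) *\<^sub>R G \<theta>) \<longlonglongrightarrow>
          indicator (\<Union>k. A k) (torus_point \<theta>) *\<^sub>R G \<theta>"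
        using sums by (intro AE_I2 tendsto_intros) (simp add: sums_def)
      show "AE \<theta> in torus_measure. norm ((\<Sum>k<m. indicator (A k) (torus_point \<theta>)) *\<^sub>R G \<theta>) \<le> cmod (G \<theta>)" for m
      proof (rule AE_I2)
        fix \<theta>
        have "(\<Sum>k<m. indicator (A k) (torus_point \<theta>)) \<le> (indicator (\<Union>k. A k) (torus_point \<theta>) :: real)"
          using sums[of "torus_point \<theta>"] by (metis sum_le_suminf sums_iff finite_lessThan indicator_pos_le)
        also have "\<dots> \<le> 1" by simp
        finally have "\<bar>\<Sum>k<m. indicator (A k) (torus_point \<theta>) :: real\<bar> \<le> 1"
          by (simp add: sum_nonneg)
        then show "norm ((\<Sum>k<m. indicator (A k) (torus_point \<theta>)) *\<^sub>R G \<theta>) \<le> cmod (G \<theta>)"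
          using mult_right_mono[of "\<bar>\<Sum>k<m. indicator (A k) (torus_point \<theta>)\<bar>" 1 "cmod (G \<theta>)"] by simp
      qed
      show "(\<lambda>\<theta>. indicator (\<Union>k. A k) (torus_point \<theta>) *\<^sub>R G \<theta>) \<in> borel_measurable torus_measure"
        using A by (intro borel_measurable_integrable i sets.countable_UN) auto
    qed (use iG A in auto)
    moreover have "(\<integral>\<theta>. (\<Sum>k<m. indicator (A k) (torus_point \<theta>)) *\<^sub>R G \<theta> \<partial>torus_measure) = 0" for m
    proof -
      have "(\<integral>\<theta>. (\<Sum>k<m. indicator (A k) (torus_point \<theta>)) *\<^sub>R G \<theta> \<partial>torus_measure) =
        (\<Sum>k<m. \<integral>\<theta>. indicator (A k) (torus_point \<theta>) *\<^sub>R G \<theta> \<partial>torus_measure)"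
        unfolding scaleR_left.sum by (intro Bochner_Integration.integral_sum i A)
      then show ?thesis using union by simp
    qed
    ultimately show ?case by (simp add: LIMSEQ_const_iff)
  qed
qed

text \<open>A Borel left inverse of \<open>cis\<close> on \<open>{-pi<..pi}\<close>.
  \<open>Arg\<close> is continuous off the nonpositive reals; of that cut only \<open>-1\<close>
  lies on the unit circle, and its angle is \<open>pi\<close>, so the whole cut can be given the
  constant value \<open>pi\<close>.\<close>

lemma cis_inverse_measurable:
  defines "a \<equiv> \<lambda>z. if z \<in> - \<real>\<^sub>\<le>\<^sub>0 then Arg z else pi"
  shows "a \<in> measurable borel circle_measure"
    and "t \<in> {-pi<..pi} \<Longrightarrow> a (cis t) = t"
proof -
  have "a \<in> borel_measurable borel"
    unfolding a_def by (rule borel_measurable_continuous_on_if) (auto intro: continuous_on_Arg)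
  moreover have "a \<in> space borel \<rightarrow> {-pi..pi}"
    using mpi_less_Arg Arg_le_pi by (auto simp: a_def less_imp_le)
  ultimately show "a \<in> measurable borel circle_measure"
    unfolding circle_measure_def by (intro measurable_restrict_space2) auto
next
  assume t: "t \<in> {-pi<..pi}"
  show "a (cis t) = t"
  proof (cases "cis t \<in> \<real>\<^sub>\<le>\<^sub>0")
    case True
    then have "Im (cis t) = 0" "Re (cis t) \<le> 0"
      by (auto simp: complex_nonpos_Reals_iff)
    moreover have "Re (cis t) \<noteq> 0"
      using calculation(1) norm_cis[of t] by (auto simp: cmod_def simp del: norm_cis)
    ultimately have "Arg (cis t) = pi" by (simp add: Arg_eq_pi)
    then show ?thesis using True Arg_cis[OF t] by (simp add: a_def)
  next
    case False
    then show ?thesis using Arg_cis[OF t] by (simp add: a_def)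
  qed
qed

lemma AE_torus_neq: "AE \<theta> in torus_measure. \<theta> (i::'d::finite) \<noteq> t"
proof -
  define N where "N = (\<lambda>k. if k = i then {t} \<inter> {-pi..pi} else space circle_measure)"
  have N: "N k \<in> sets circle_measure" for k
  proof (cases "k = i")
    case True
    then show ?thesis
      by (auto simp: N_def circle_measure_def sets_restrict_space intro!: image_eqI[of _ _ "{t}"])
  qed (auto simp: N_def simp del: space_circle_measure)
  have "emeasure circle_measure (N i) = 0"
    by (simp add: N_def circle_measure_def emeasure_restrict_space Int_insert_left)
  then have "emeasure (torus_measure :: ('d \<Rightarrow> real) measure) (Pi\<^sub>E UNIV N) = 0"
    unfolding torus_measure_def using N
    by (subst circle_prod.emeasure_PiM) (auto intro!: prod_zero)
  moreover have "Pi\<^sub>E UNIV N \<in> sets (torus_measure :: ('d \<Rightarrow> real) measure)"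
    unfolding torus_measure_def using N by (intro sets_PiM_I_finite) auto
  ultimately have "Pi\<^sub>E UNIV N \<in> null_sets torus_measure" by (simp add: null_setsI)
  moreover have "{\<theta> \<in> space torus_measure. \<not> \<theta> i \<noteq> t} \<subseteq> Pi\<^sub>E UNIV N"
    by (auto simp: N_def PiE_iff)
  ultimately show ?thesis by (rule AE_I')
qed

lemma torus_total:
  fixes G :: "('d::finite \<Rightarrow> real) \<Rightarrow> complex"
  assumes G: "G \<in> L2 torus_measure" and coef: "\<And>n. coef torus_measure torus_char G n = 0"
  shows "AE \<theta> in torus_measure. G \<theta> = 0"
proof -
  have iG: "integrable torus_measure G" by (rule L2_torus_integrable[OF G])
  have [measurable]: "G \<in> borel_measurable torus_measure" using iG by simp
  define a :: "complex \<Rightarrow> real" where "a = (\<lambda>z. if z \<in> - \<real>\<^sub>\<le>\<^sub>0 then Arg z else pi)"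
  have a: "a \<in> measurable borel circle_measure" "\<And>t. t \<in> {-pi<..pi} \<Longrightarrow> a (cis t) = t"
    using cis_inverse_measurable by (auto simp: a_def)
  have inv: "(\<lambda>z i. a (z i)) \<in> measurable borel (torus_measure :: ('d \<Rightarrow> real) measure)"
    unfolding torus_measure_def
  proof (rule measurable_PiM_single')
    show "(\<lambda>z. a (z i)) \<in> measurable borel circle_measure" for i :: 'd
      by (rule measurable_compose[OF measurable_product_coordinates a(1)])
    then show "(\<lambda>z i. a (z i)) \<in> space borel \<rightarrow> (\<Pi>\<^sub>E i\<in>(UNIV :: 'd set). space circle_measure)"
      using measurable_space[OF a(1)] by (auto simp: PiE_iff simp del: space_circle_measure)
  qed
  have zero: "(\<integral>\<theta>. indicator A \<theta> *\<^sub>R G \<theta> \<partial>torus_measure) = 0" if A[measurable]: "A \<in> sets torus_measure" for A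
  proof -
    \<comment> \<open>\<open>B\<close> transports \<open>A\<close> to the product of circles: for
      \<open>\<theta>\<close> in the cube with no coordinate equal to \<open>- pi\<close>,
      \<open>\<theta>\<close> lies in \<open>A\<close> iff \<open>torus_point \<theta>\<close> lies
      in \<open>B\<close>.\<close>
    define B where "B = (\<lambda>z i. a (z i)) -` A"
    have B[measurable]: "B \<in> sets borel"
      using measurable_sets[OF inv A] by (simp add: B_def)
    have "(\<integral>\<theta>. indicator A \<theta> *\<^sub>R G \<theta> \<partial>torus_measure) =
        (\<integral>\<theta>. indicator B (torus_point \<theta>) *\<^sub>R G \<theta> \<partial>torus_measure)"
    proof (rule integral_cong_AE)
      have "AE \<theta> in torus_measure. \<forall>i\<in>UNIV. (\<theta> :: 'd \<Rightarrow> real) i \<noteq> -pi"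
        by (intro AE_finite_allI AE_torus_neq) simp
      with AE_space show "AE \<theta> in torus_measure. indicator A \<theta> *\<^sub>R G \<theta> = indicator B (torus_point \<theta>) *\<^sub>R G \<theta>"
      proof eventually_elim
        case (elim \<theta>)
        then have "a (cis (\<theta> i)) = \<theta> i" for i
          by (intro a(2)) (auto simp: less_le)
        then show ?case by (simp add: B_def torus_point_def indicator_def)
      qed
    qed measurable
    then show ?thesis using torus_integral_borel_eq_0[OF G coef B] by simp
  qed
  \<comment> \<open>Uniqueness of densities is applied to real functions, hence separately to the
    real and the imaginary part.\<close>
  have part: "AE \<theta> in torus_measure. u (G \<theta>) = 0" if u: "bounded_linear u" for u :: "complex \<Rightarrow> real"
  proof (rule density_unique_real)
    interpret u: bounded_linear u by (rule u)
    show "integrable torus_measure (\<lambda>\<theta>. u (G \<theta>))"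
      by (rule integrable_bounded_linear[OF u iG])
    fix A :: "('d \<Rightarrow> real) set" assume [measurable]: "A \<in> sets torus_measure"
    have "(\<integral>\<theta>\<in>A. u (G \<theta>) \<partial>torus_measure) = (\<integral>\<theta>. u (indicator A \<theta> *\<^sub>R G \<theta>) \<partial>torus_measure)"
      by (simp add: set_lebesgue_integral_def u.scaleR)
    also have "\<dots> = u (\<integral>\<theta>. indicator A \<theta> *\<^sub>R G \<theta> \<partial>torus_measure)"
      by (intro integral_bounded_linear u integrable_mult_indicator iG) measurable
    finally show "(\<integral>\<theta>\<in>A. u (G \<theta>) \<partial>torus_measure) = (\<integral>\<theta>\<in>A. 0 \<partial>torus_measure)"
      using zero[of A] by (simp add: u.zero set_lebesgue_integral_def)
  qed simp
  show ?thesis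
    using part[OF bounded_linear_Re] part[OF bounded_linear_Im]
    by eventually_elim (simp add: complex_eq_iff)
qed

interpretation torus: ortho_basis torus_measure "torus_char :: ('d::finite \<Rightarrow> int) \<Rightarrow> _"
  by standard (auto simp: torus_char_L2 coef_torus_char torus_total)

text \<open>The circle is the torus over a one-element index type.\<close>

lemma circle_total:
  assumes g: "g \<in> L2 circle_measure" and coef: "\<And>n. coef circle_measure circle_char g n = 0"
  shows "AE \<theta> in circle_measure. g \<theta> = 0"
proof -
  define G where "G = (\<lambda>\<theta> :: unit \<Rightarrow> real. \<Prod>i\<in>UNIV. g (\<theta> i))"
  have G: "G \<in> L2 torus_measure" "sqnorm torus_measure G = sqnorm circle_measure g"
    using L2_torus_prod[of "\<lambda>_ :: unit. g"] g by (simp_all add: G_def)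
  have "coef torus_measure torus_char G n = 0" for n
    using coef_torus_prod[of "\<lambda>_ :: unit. g" n] g coef by (simp add: G_def)
  then have "AE \<theta> in torus_measure. G \<theta> = 0"
    by (rule torus_total[OF G(1)])
  \<comment> \<open>The squared norms agree, so the conclusion passes from torus to circle without
    comparing null sets.\<close>
  then have "sqnorm circle_measure g = 0"
    using sqnorm_eq_0_iff[OF G(1)] G(2) by simp
  then show ?thesis using sqnorm_eq_0_iff[OF g] by simp
qed

interpretation circle: ortho_basis circle_measure circle_char
  by standard (auto simp: circle_char_L2 coef_def integral_circle_char intro: circle_total[unfolded coef_def])

lemma L2_dominated:
  assumes "g \<in> L2 M" "f \<in> borel_measurable M" "\<And>x. x \<in> space M \<Longrightarrow> cmod (f x) \<le> cmod (g x)"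
  shows "f \<in> L2 M"
proof -
  have "integrable M (\<lambda>x. (cmod (f x))\<^sup>2)"
    by (rule Bochner_Integration.integrable_bound[of M "\<lambda>x. (cmod (g x))\<^sup>2"])
      (use assms in \<open>auto simp: L2_def intro!: AE_I2 power_mono\<close>)
  then show ?thesis using assms by (simp add: L2_def)
qed

lemma ell2_norm_nonneg: "0 \<le> ell2_norm f"
  by (simp add: ell2_norm_def infsum_nonneg)

lemma ell2_closure_iff:
  "(f, h) \<in> ell2_closure A \<longleftrightarrow> f \<in> ell2 \<and> h \<in> ell2 \<and>
    (\<exists>u w. (\<forall>k::nat. (u k, w k) \<in> A) \<and> (\<lambda>k. ell2_norm (\<lambda>n. u k n - f n)) \<longlonglongrightarrow> 0 \<and>
      (\<lambda>k. ell2_norm (\<lambda>n. w k n - h n)) \<longlonglongrightarrow> 0)"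
  by (simp add: ell2_closure_def)

lemma ell2_closure_mono:
  assumes "A \<subseteq> B" shows "ell2_closure A \<subseteq> ell2_closure B"
proof (rule subrelI)
  fix f h assume "(f, h) \<in> ell2_closure A"
  then obtain u w where "f \<in> ell2" "h \<in> ell2" "\<And>k::nat. (u k, w k) \<in> A"
    "(\<lambda>k. ell2_norm (\<lambda>n. u k n - f n)) \<longlonglongrightarrow> 0" "(\<lambda>k. ell2_norm (\<lambda>n. w k n - h n)) \<longlonglongrightarrow> 0"
    unfolding ell2_closure_iff by auto
  then show "(f, h) \<in> ell2_closure B"
    using assms unfolding ell2_closure_iff by (intro conjI exI[of _ u] exI[of _ w]) auto
qed

subsection \<open>Fourier multipliers\<close>

context ortho_basis
begin

text \<open>Multiplying by the bounded function \<open>1 / (1 + m)\<close> makes both sides of \<open>k = m g\<close> continuous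
  in \<open>L\<^sup>2\<close>.\<close>

lemma fourier_multiplier_closed:
  assumes m: "m \<in> borel_measurable M" and m0: "\<And>x. 0 \<le> m x"
  shows "ell2_closure (fourier_multiplier M e m) \<subseteq> fourier_multiplier M e m"
proof (rule subrelI)
  fix f h assume "(f, h) \<in> ell2_closure (fourier_multiplier M e m)"
  then obtain u w where fh: "f \<in> ell2" "h \<in> ell2"
    and uw: "\<And>i::nat. (u i, w i) \<in> fourier_multiplier M e m"
    and u: "(\<lambda>i. ell2_norm (\<lambda>n. u i n - f n)) \<longlonglongrightarrow> 0"
    and w: "(\<lambda>i. ell2_norm (\<lambda>n. w i n - h n)) \<longlonglongrightarrow> 0"
    unfolding ell2_closure_iff by auto
  obtain g where g: "g \<in> L2 M" "f = coef M e g" using fh(1) ell2_eq_coef_image by auto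
  obtain k where k: "k \<in> L2 M" "h = coef M e k" using fh(2) ell2_eq_coef_image by auto
  obtain G where G: "\<And>i. G i \<in> L2 M" "\<And>i. (\<lambda>x. of_real (m x) * G i x) \<in> L2 M"
    "\<And>i. u i = coef M e (G i)" "\<And>i. w i = coef M e (\<lambda>x. of_real (m x) * G i x)"
    using uw unfolding fourier_multiplier_iff by metis
  define b where "b = (\<lambda>x. 1 / (1 + m x))"
  \<comment> \<open>\<open>p\<close> is \<open>b\<close> times \<open>m g - k\<close>. As
    \<open>b\<close> is positive, \<open>p = 0\<close> is the wanted relation, and \<open>p\<close>
    lies in \<open>L2 M\<close> although \<open>m g\<close> is not yet known to.\<close>
  define p where "p = (\<lambda>x. of_real (b x * m x) * g x - of_real (b x) * k x)"
  have bm: "b \<in> borel_measurable M" "(\<lambda>x. b x * m x) \<in> borel_measurable M"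
    unfolding b_def using m by auto
  have b1: "\<bar>b x\<bar> \<le> 1" "\<bar>b x * m x\<bar> \<le> 1" for x
    using m0[of x] by (auto simp: b_def)
  have pL: "p \<in> L2 M"
    unfolding p_def by (intro L2_diff L2_mult_bounded[where C = 1] g k bm b1)
  have contr: "sqnorm M (\<lambda>x. of_real (c x) * a x) \<le> sqnorm M a"
    if "a \<in> L2 M" "c \<in> borel_measurable M" "\<And>x. \<bar>c x\<bar> \<le> 1" for a and c :: "'a \<Rightarrow> real"
    by (intro sqnorm_mono L2_mult_bounded[where C = 1] that) (use that in \<open>auto simp: norm_mult mult_left_le_one_le\<close>)
  have bound: "sqnorm M p \<le> 2 * (ell2_norm (\<lambda>n. u i n - f n))\<^sup>2 + 2 * (ell2_norm (\<lambda>n. w i n - h n))\<^sup>2" for i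
  proof -
    define d1 where "d1 = (\<lambda>x. G i x - g x)"
    define d2 where "d2 = (\<lambda>x. of_real (m x) * G i x - k x)"
    have dL: "d1 \<in> L2 M" "d2 \<in> L2 M"
      unfolding d1_def d2_def by (intro L2_diff G g k)+
    \<comment> \<open>The pair \<open>G i\<close>, \<open>m G i\<close> satisfies the relation
      exactly, so its contributions cancel and only the two errors remain.\<close>
    have "p = (\<lambda>x. of_real (- (b x * m x)) * d1 x + of_real (b x) * d2 x)"
      by (simp add: p_def d1_def d2_def fun_eq_iff algebra_simps)
    then have "sqnorm M p \<le> 2 * sqnorm M (\<lambda>x. of_real (- (b x * m x)) * d1 x) + 2 * sqnorm M (\<lambda>x. of_real (b x) * d2 x)"
      by (simp only:) (intro sqnorm_add_le L2_mult_bounded[where C = 1] dL borel_measurable_uminus bm; use b1 in simp)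
    also have "\<dots> \<le> 2 * sqnorm M d1 + 2 * sqnorm M d2"
      by (intro add_mono mult_left_mono contr dL borel_measurable_uminus bm) (use b1 in auto)
    also have "sqnorm M d1 = (ell2_norm (\<lambda>n. u i n - f n))\<^sup>2"
      using ell2_norm_coef_diff[OF G(1) g(1)] by (simp add: G(3) g(2) d1_def sqnorm_nonneg)
    also have "sqnorm M d2 = (ell2_norm (\<lambda>n. w i n - h n))\<^sup>2"
      using ell2_norm_coef_diff[OF G(2) k(1)] by (simp add: G(4) k(2) d2_def sqnorm_nonneg)
    finally show ?thesis .
  qed
  have "(\<lambda>i. 2 * (ell2_norm (\<lambda>n. u i n - f n))\<^sup>2 + 2 * (ell2_norm (\<lambda>n. w i n - h n))\<^sup>2) \<longlonglongrightarrow> 2 * 0\<^sup>2 + 2 * 0\<^sup>2"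
    by (intro tendsto_intros u w)
  then have "sqnorm M p \<le> 2 * 0\<^sup>2 + 2 * 0\<^sup>2"
    by (rule tendsto_lowerbound) (auto simp: bound)
  then have "sqnorm M p = 0" using sqnorm_nonneg[of M p] by simp
  then have "AE x in M. p x = 0" using sqnorm_eq_0_iff[OF pL] by simp
  then have ae: "AE x in M. k x = of_real (m x) * g x"
  proof eventually_elim
    case (elim x)
    have "b x \<noteq> 0" using m0[of x] by (simp add: b_def)
    moreover have "of_real (b x) * (of_real (m x) * g x - k x) = 0"
      using elim by (simp add: p_def algebra_simps)
    ultimately show ?case by simp
  qed
  have mg: "(\<lambda>x. of_real (m x) * g x) \<in> L2 M"
    using ae g m by (intro L2_cong_AE[OF k(1)]) (auto simp: L2_def)
  then have "h = coef M e (\<lambda>x. of_real (m x) * g x)"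
    using coef_eq_iff_AE[OF k(1) mg] ae k(2) by simp
  then show "(f, h) \<in> fourier_multiplier M e m"
    unfolding fourier_multiplier_iff using g mg by blast
qed

text \<open>The range of the bounded multiplication by \<open>1 / (1 + m)\<close> on finite sums of characters is a core.\<close>

lemma fourier_multiplier_core:
  assumes m: "m \<in> borel_measurable M" and m0: "\<And>x. 0 \<le> m x"
    and A: "\<And>F c. finite F \<Longrightarrow>
      (coef M e (\<lambda>x. of_real (1 / (1 + m x)) * (\<Sum>n\<in>F. c n * e n x)),
       coef M e (\<lambda>x. of_real (m x) * (of_real (1 / (1 + m x)) * (\<Sum>n\<in>F. c n * e n x)))) \<in> A"
  shows "fourier_multiplier M e m \<subseteq> ell2_closure A"
proof (rule subrelI)
  fix f h assume "(f, h) \<in> fourier_multiplier M e m"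
  then obtain g where g: "g \<in> L2 M" and mg: "(\<lambda>x. of_real (m x) * g x) \<in> L2 M"
    and f: "f = coef M e g" and h: "h = coef M e (\<lambda>x. of_real (m x) * g x)"
    unfolding fourier_multiplier_iff by blast
  define b where "b = (\<lambda>x. 1 / (1 + m x))"
  \<comment> \<open>\<open>q = (1 + m) g\<close>, so that \<open>g = b q\<close> and
    \<open>m g = (m b) q\<close> with both factors bounded by 1: a single approximation of
    \<open>q\<close> by partial sums approximates both components of the graph.\<close>
  define q where "q = (\<lambda>x. g x + of_real (m x) * g x)"
  have q: "q \<in> L2 M" unfolding q_def by (intro L2_add g mg)
  have bq: "g x = of_real (b x) * q x" for x
  proof -
    have "complex_of_real (1 + m x) \<noteq> 0"
      using m0[of x] by (metis add_nonneg_eq_0_iff of_real_eq_0_iff zero_le_one zero_neq_one)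
    then show ?thesis by (simp add: b_def q_def field_simps)
  qed
  have bm: "b \<in> borel_measurable M" "(\<lambda>x. m x * b x) \<in> borel_measurable M"
    unfolding b_def using m by auto
  have b1: "\<bar>b x\<bar> \<le> 1" "\<bar>m x * b x\<bar> \<le> 1" for x
    using m0[of x] by (auto simp: b_def)
  have contr: "sqnorm M (\<lambda>x. of_real (c x) * a x) \<le> sqnorm M a"
    if "a \<in> L2 M" "c \<in> borel_measurable M" "\<And>x. \<bar>c x\<bar> \<le> 1" for a and c :: "'a \<Rightarrow> real"
    by (intro sqnorm_mono L2_mult_bounded[where C = 1] that) (use that in \<open>auto simp: norm_mult mult_left_le_one_le\<close>)
  define S where "S = (\<lambda>F x. \<Sum>n\<in>F. coef M e q n * e n x)"
  have SL: "S F \<in> L2 M" if "finite F" for F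
    unfolding S_def by (rule partial_sum_L2[OF that])
  have lim: "((\<lambda>F. sqnorm M (\<lambda>x. q x - S F x)) \<longlongrightarrow> 0) (finite_subsets_at_top UNIV)"
    using q has_dft_iff[of "coef M e q" q] by (simp add: has_dft_iff_sqnorm S_def)
  have "\<exists>F. finite F \<and> sqnorm M (\<lambda>x. q x - S F x) < 1 / Suc i" for i
  proof -
    have "\<forall>\<^sub>F F in finite_subsets_at_top UNIV. sqnorm M (\<lambda>x. q x - S F x) < 1 / Suc i"
      by (rule order_tendstoD[OF lim]) simp
    then show ?thesis unfolding eventually_finite_subsets_at_top by blast
  qed
  then obtain F where F: "\<And>i. finite (F i)" "\<And>i. sqnorm M (\<lambda>x. q x - S (F i) x) < 1 / Suc i"
    by metis
  have approx: "(\<lambda>i. ell2_norm (\<lambda>n. coef M e (\<lambda>x. of_real (c x) * S (F i) x) n -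
      coef M e (\<lambda>x. of_real (c x) * q x) n)) \<longlonglongrightarrow> 0"
    if c: "c \<in> borel_measurable M" "\<And>x. \<bar>c x\<bar> \<le> 1" for c :: "'a \<Rightarrow> real"
  proof (rule tendsto_sandwich[OF _ _ tendsto_const])
    have cL: "(\<lambda>x. of_real (c x) * a x) \<in> L2 M" if "a \<in> L2 M" for a
      by (intro L2_mult_bounded[where C = 1] that c)
    have "ell2_norm (\<lambda>n. coef M e (\<lambda>x. of_real (c x) * S (F i) x) n - coef M e (\<lambda>x. of_real (c x) * q x) n)
        \<le> sqrt (1 / Suc i)" for i
    proof -
      have "sqnorm M (\<lambda>x. of_real (c x) * S (F i) x - of_real (c x) * q x)
          = sqnorm M (\<lambda>x. of_real (c x) * (q x - S (F i) x))"
        unfolding sqnorm_def by (simp add: norm_minus_commute flip: right_diff_distrib) (simp add: norm_mult norm_minus_commute)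
      also have "\<dots> \<le> sqnorm M (\<lambda>x. q x - S (F i) x)"
        by (intro contr c L2_diff q SL F)
      finally show ?thesis
        using F(2)[of i] by (subst ell2_norm_coef_diff) (auto intro!: cL SL F q)
    qed
    then show "\<forall>\<^sub>F i in sequentially. ell2_norm (\<lambda>n. coef M e (\<lambda>x. of_real (c x) * S (F i) x) n
        - coef M e (\<lambda>x. of_real (c x) * q x) n) \<le> sqrt (1 / Suc i)"
      by simp
    show "\<forall>\<^sub>F i in sequentially. 0 \<le> ell2_norm (\<lambda>n. coef M e (\<lambda>x. of_real (c x) * S (F i) x) n
        - coef M e (\<lambda>x. of_real (c x) * q x) n)"
      by (simp add: ell2_norm_nonneg)
    show "(\<lambda>i. sqrt (1 / Suc i)) \<longlonglongrightarrow> 0"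
      using tendsto_real_sqrt[OF LIMSEQ_inverse_real_of_nat] by (simp add: inverse_eq_divide)
  qed
  have f': "f = coef M e (\<lambda>x. of_real (b x) * q x)"
    and h': "h = coef M e (\<lambda>x. of_real (m x * b x) * q x)"
    using f h by (simp_all add: bq[symmetric] mult.assoc)
  show "(f, h) \<in> ell2_closure A"
    unfolding ell2_closure_iff
  proof (intro conjI exI allI)
    show "f \<in> ell2" "h \<in> ell2" using f h g mg coef_ell2 by auto
    show "(coef M e (\<lambda>x. of_real (b x) * S (F i) x), coef M e (\<lambda>x. of_real (m x * b x) * S (F i) x)) \<in> A" for i
      using A[OF F(1)[of i], of "coef M e q"] by (simp add: S_def b_def mult.assoc)
    show "(\<lambda>i. ell2_norm (\<lambda>n. coef M e (\<lambda>x. of_real (b x) * S (F i) x) n - f n)) \<longlonglongrightarrow> 0"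
      unfolding f' by (intro approx bm b1)
    show "(\<lambda>i. ell2_norm (\<lambda>n. coef M e (\<lambda>x. of_real (m x * b x) * S (F i) x) n - h n)) \<longlonglongrightarrow> 0"
      unfolding h' by (intro approx bm b1)
  qed
qed

end

subsection \<open>Operators in one tensor slot\<close>

lemma mult_slot_prod:
  fixes g :: "'d::finite \<Rightarrow> real \<Rightarrow> complex"
  shows "c (\<theta> j) * (\<Prod>i\<in>UNIV. g i (\<theta> i)) = (\<Prod>i\<in>UNIV. (g(j := \<lambda>t. c t * g j t)) i (\<theta> i))"
proof -
  have "(\<Prod>i\<in>UNIV - {j}. (g(j := \<lambda>t. c t * g j t)) i (\<theta> i)) = (\<Prod>i\<in>UNIV - {j}. g i (\<theta> i))"
    by (intro prod.cong) auto
  then show ?thesis by (simp add: prod.remove[of UNIV j] mult_ac)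
qed

lemma coef_torus_sum_prod:
  assumes "\<And>k i. k < N \<Longrightarrow> g k i \<in> L2 circle_measure"
  shows "coef torus_measure torus_char (\<lambda>\<theta>. \<Sum>k<N. \<Prod>i\<in>UNIV. g k i (\<theta> i)) =
    (\<lambda>n. \<Sum>k<N. tensor (\<lambda>i. coef circle_measure circle_char (g k i)) n)"
proof
  fix n
  have "coef torus_measure torus_char (\<lambda>\<theta>. \<Sum>k<N. \<Prod>i\<in>UNIV. g k i (\<theta> i)) n =
      (\<Sum>k<N. coef torus_measure torus_char (\<lambda>\<theta>. \<Prod>i\<in>UNIV. g k i (\<theta> i)) n)"
    by (intro coef_sum L2_torus_prod torus_char_L2) (use assms in auto)
  also have "\<dots> = (\<Sum>k<N. tensor (\<lambda>i. coef circle_measure circle_char (g k i)) n)"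
    using assms by (intro sum.cong refl) (simp add: coef_torus_prod tensor_def)
  finally show "coef torus_measure torus_char (\<lambda>\<theta>. \<Sum>k<N. \<Prod>i\<in>UNIV. g k i (\<theta> i)) n = \<dots>" .
qed

lemma alg_tensor_slot_iff:
  "(u, w) \<in> alg_tensor_slot j A \<longleftrightarrow>
    (\<exists>(N::nat) \<phi> v. u = (\<lambda>n. \<Sum>k<N. tensor (\<phi> k) n) \<and> w = (\<lambda>n. \<Sum>k<N. tensor ((\<phi> k)(j := v k)) n) \<and>
      (\<forall>k<N. (\<forall>i. \<phi> k i \<in> ell2) \<and> (\<phi> k j, v k) \<in> A))"
  unfolding alg_tensor_slot_def mem_Collect_eq prod.inject conj_assoc ..

text \<open>The graph as seen through the transform: elementary tensors become products of
  one-variable functions, and changing the \<open>j\<close>-th factors becomes one multiplication of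
  the whole sum by \<open>m (\<theta> j)\<close>.\<close>

lemma alg_tensor_slot_fourier_multiplier_iff:
  "(u, w) \<in> alg_tensor_slot j (fourier_multiplier circle_measure circle_char m) \<longleftrightarrow>
    (\<exists>(N::nat) g. (\<forall>k<N. (\<forall>i. g k i \<in> L2 circle_measure) \<and> (\<lambda>t. of_real (m t) * g k j t) \<in> L2 circle_measure) \<and>
      u = coef torus_measure torus_char (\<lambda>\<theta>. \<Sum>k<N. \<Prod>i\<in>UNIV. g k i (\<theta> i)) \<and>
      w = coef torus_measure torus_char (\<lambda>\<theta>. of_real (m (\<theta> j)) * (\<Sum>k<N. \<Prod>i\<in>UNIV. g k i (\<theta> i))))"
    (is "?L \<longleftrightarrow> ?R")
proof -
  let ?coef = "coef circle_measure circle_char"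
  let ?m = "\<lambda>g t. of_real (m t) * g t"
  have val: "coef torus_measure torus_char (\<lambda>\<theta>. of_real (m (\<theta> j)) * (\<Sum>k<N. \<Prod>i\<in>UNIV. g k i (\<theta> i))) =
      (\<lambda>n. \<Sum>k<N. tensor ((\<lambda>i. ?coef (g k i))(j := ?coef (?m (g k j)))) n)"
    if g: "\<forall>k<N. (\<forall>i. g k i \<in> L2 circle_measure) \<and> ?m (g k j) \<in> L2 circle_measure" for N g
  proof -
    have upd: "(\<lambda>i. ?coef (g k i))(j := ?coef (?m (g k j))) = (\<lambda>i. ?coef (((g k)(j := ?m (g k j))) i))" for k
      by (auto simp: fun_eq_iff)
    show ?thesis
      unfolding sum_distrib_left mult_slot_prod[of "\<lambda>t. of_real (m t)"] upd
      by (rule coef_torus_sum_prod) (use g in auto)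
  qed
  show ?thesis
  proof (unfold alg_tensor_slot_iff, rule iffI, elim exE conjE)
    fix N :: nat and \<phi> v
    assume u: "u = (\<lambda>n. \<Sum>k<N. tensor (\<phi> k) n)"
      and w: "w = (\<lambda>n. \<Sum>k<N. tensor ((\<phi> k)(j := v k)) n)"
      and \<phi>': "\<forall>k<N. (\<forall>i. \<phi> k i \<in> ell2) \<and> (\<phi> k j, v k) \<in> fourier_multiplier circle_measure circle_char m"
    have \<phi>: "\<And>k i. k < N \<Longrightarrow> \<phi> k i \<in> ell2"
      "\<And>k. k < N \<Longrightarrow> (\<phi> k j, v k) \<in> fourier_multiplier circle_measure circle_char m"
      using \<phi>' by auto
    \<comment> \<open>In slot \<open>j\<close> a single function must represent
      \<open>\<phi> k j\<close> and, multiplied by \<open>m\<close>, also \<open>v k\<close>; the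
      other slots only ask for a representative. \<open>P\<close> states both demands at once, so
      that one choice covers all slots.\<close>
    define P where "P = (\<lambda>k i g. g \<in> L2 circle_measure \<and> \<phi> k i = ?coef g \<and>
        (i = j \<longrightarrow> ?m g \<in> L2 circle_measure \<and> v k = ?coef (?m g)))"
    define g where "g = (\<lambda>k i. SOME h. P k i h)"
    have ex: "\<exists>h. P k i h" if k: "k < N" for k i
    proof (cases "i = j")
      case True
      obtain h where "h \<in> L2 circle_measure" "?m h \<in> L2 circle_measure" "\<phi> k j = ?coef h" "v k = ?coef (?m h)"
        using \<phi>(2)[OF k] unfolding circle.fourier_multiplier_iff by (elim bexE conjE)
      then show ?thesis using True unfolding P_def by (intro exI[of _ h]) simp
    next
      case False
      obtain h where "\<phi> k i = ?coef h" "h \<in> L2 circle_measure"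
        using \<phi>(1)[OF k, of i] unfolding circle.ell2_eq_coef_image by (rule imageE)
      then show ?thesis using False unfolding P_def by (intro exI[of _ h]) simp
    qed
    have "P k i (g k i)" if "k < N" for k i
      unfolding g_def by (rule someI_ex[OF ex[OF that]])
    then have g: "g k i \<in> L2 circle_measure \<and> \<phi> k i = ?coef (g k i) \<and>
        (i = j \<longrightarrow> ?m (g k i) \<in> L2 circle_measure \<and> v k = ?coef (?m (g k i)))" if "k < N" for k i
      using that by (simp add: P_def)
    have L: "\<forall>k<N. (\<forall>i. g k i \<in> L2 circle_measure) \<and> ?m (g k j) \<in> L2 circle_measure"
      by (intro allI impI conjI) (simp_all add: g)
    have "\<phi> k = (\<lambda>i. ?coef (g k i))" "v k = ?coef (?m (g k j))" if "k < N" for k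
      using g[OF that] by (auto simp: fun_eq_iff)
    then have uw: "u = coef torus_measure torus_char (\<lambda>\<theta>. \<Sum>k<N. \<Prod>i\<in>UNIV. g k i (\<theta> i))"
      "w = coef torus_measure torus_char (\<lambda>\<theta>. of_real (m (\<theta> j)) * (\<Sum>k<N. \<Prod>i\<in>UNIV. g k i (\<theta> i)))"
      unfolding val[OF L] u w using L by (auto simp: coef_torus_sum_prod)
    show ?R by (intro exI[of _ N] exI[of _ g] conjI L uw)
  next
    assume ?R
    then obtain N :: nat and g where
      g: "\<forall>k<N. (\<forall>i. g k i \<in> L2 circle_measure) \<and> ?m (g k j) \<in> L2 circle_measure"
      and u: "u = coef torus_measure torus_char (\<lambda>\<theta>. \<Sum>k<N. \<Prod>i\<in>UNIV. g k i (\<theta> i))"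
      and w: "w = coef torus_measure torus_char (\<lambda>\<theta>. of_real (m (\<theta> j)) * (\<Sum>k<N. \<Prod>i\<in>UNIV. g k i (\<theta> i)))"
      by blast
    have "u = (\<lambda>n. \<Sum>k<N. tensor (\<lambda>i. ?coef (g k i)) n)"
      unfolding u by (rule coef_torus_sum_prod) (use g in auto)
    moreover have "\<forall>k<N. (\<forall>i. ?coef (g k i) \<in> ell2) \<and>
        (?coef (g k j), ?coef (?m (g k j))) \<in> fourier_multiplier circle_measure circle_char m"
      unfolding circle.fourier_multiplier_iff using g circle.coef_ell2 by blast
    ultimately show "\<exists>(N::nat) \<phi> v. u = (\<lambda>n. \<Sum>k<N. tensor (\<phi> k) n) \<and> w = (\<lambda>n. \<Sum>k<N. tensor ((\<phi> k)(j := v k)) n) \<and>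
      (\<forall>k<N. (\<forall>i. \<phi> k i \<in> ell2) \<and> (\<phi> k j, v k) \<in> fourier_multiplier circle_measure circle_char m)"
      unfolding w val[OF g]
      by (intro exI[of _ N] exI[of _ "\<lambda>k i. ?coef (g k i)"] exI[of _ "\<lambda>k. ?coef (?m (g k j))"]) simp
  qed
qed

text \<open>From left to right, the multiplication operator is closed and contains the algebraic
  tensor graph. From right to left, its core consists of finite sums of products, since
  \<open>1 / (1 + m (\<theta> j))\<close> involves one coordinate.\<close>

theorem tensor_slot_fourier_multiplier:
  assumes m: "m \<in> borel_measurable circle_measure" and m0: "\<And>t. 0 \<le> m t"
  shows "tensor_slot j (fourier_multiplier circle_measure circle_char m) =
    fourier_multiplier torus_measure torus_char (\<lambda>\<theta>. m (\<theta> j))"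
proof (rule antisym)
  have mj: "(\<lambda>\<theta>. m (\<theta> j)) \<in> borel_measurable torus_measure"
    by (rule torus_measurable_slot[OF m])
  have "alg_tensor_slot j (fourier_multiplier circle_measure circle_char m) \<subseteq>
      fourier_multiplier torus_measure torus_char (\<lambda>\<theta>. m (\<theta> j))"
  proof (rule subrelI)
    fix u w assume "(u, w) \<in> alg_tensor_slot j (fourier_multiplier circle_measure circle_char m)"
    then obtain N :: nat and g where
      g: "\<forall>k<N. (\<forall>i. g k i \<in> L2 circle_measure) \<and> (\<lambda>t. of_real (m t) * g k j t) \<in> L2 circle_measure"
      and u: "u = coef torus_measure torus_char (\<lambda>\<theta>. \<Sum>k<N. \<Prod>i\<in>UNIV. g k i (\<theta> i))"
      and w: "w = coef torus_measure torus_char (\<lambda>\<theta>. of_real (m (\<theta> j)) * (\<Sum>k<N. \<Prod>i\<in>UNIV. g k i (\<theta> i)))"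
      unfolding alg_tensor_slot_fourier_multiplier_iff by blast
    define G where "G = (\<lambda>\<theta>. \<Sum>k<N. \<Prod>i\<in>UNIV. g k i (\<theta> i))"
    have GL: "G \<in> L2 torus_measure"
      unfolding G_def by (rule L2_sum[OF finite_lessThan], rule L2_torus_prod(1)) (simp add: g)
    have mGL: "(\<lambda>\<theta>. of_real (m (\<theta> j)) * G \<theta>) \<in> L2 torus_measure"
      unfolding G_def sum_distrib_left mult_slot_prod[of "\<lambda>t. of_real (m t)"]
      by (rule L2_sum[OF finite_lessThan], rule L2_torus_prod(1)) (simp add: g)
    have uw: "u = coef torus_measure torus_char G"
      "w = coef torus_measure torus_char (\<lambda>\<theta>. of_real (m (\<theta> j)) * G \<theta>)"
      unfolding u w G_def by (rule refl)+
    show "(u, w) \<in> fourier_multiplier torus_measure torus_char (\<lambda>\<theta>. m (\<theta> j))"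
      unfolding torus.fourier_multiplier_iff by (intro bexI[of _ G] conjI GL mGL uw)
  qed
  then show "tensor_slot j (fourier_multiplier circle_measure circle_char m) \<subseteq>
      fourier_multiplier torus_measure torus_char (\<lambda>\<theta>. m (\<theta> j))"
    unfolding tensor_slot_def
    using torus.fourier_multiplier_closed[OF mj m0] by (rule order_trans[OF ell2_closure_mono])
  show "fourier_multiplier torus_measure torus_char (\<lambda>\<theta>. m (\<theta> j)) \<subseteq>
      tensor_slot j (fourier_multiplier circle_measure circle_char m)"
    unfolding tensor_slot_def
  proof (rule torus.fourier_multiplier_core[OF mj m0])
    fix F :: "('a \<Rightarrow> int) set" and c assume F: "finite F"
    obtain h where h: "bij_betw h {..<card F} F"
      using ex_bij_betw_nat_finite[OF F] by (auto simp: atLeast0LessThan)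
    define b where "b = (\<lambda>t. 1 / (1 + m t))"
    \<comment> \<open>Scalar and bounded factor both go into the \<open>j\<close>-th function, which
      lies in the domain of the multiplication by \<open>m\<close> because \<open>m b\<close> is
      bounded as well.\<close>
    define g where "g = (\<lambda>k. (\<lambda>i. circle_char (h k i))(j := \<lambda>t. c (h k) * of_real (b t) * circle_char (h k j) t))"
    have eq: "of_real (1 / (1 + m (\<theta> j))) * (\<Sum>n\<in>F. c n * torus_char n \<theta>) = (\<Sum>k<card F. \<Prod>i\<in>UNIV. g k i (\<theta> i))" for \<theta>
    proof -
      have "(\<Sum>n\<in>F. c n * torus_char n \<theta>) = (\<Sum>k<card F. c (h k) * torus_char (h k) \<theta>)"
        by (rule sum.reindex_bij_betw[OF h, symmetric])
      then have "of_real (1 / (1 + m (\<theta> j))) * (\<Sum>n\<in>F. c n * torus_char n \<theta>) =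
          (\<Sum>k<card F. (c (h k) * of_real (b (\<theta> j))) * torus_char (h k) \<theta>)"
        by (simp add: b_def sum_distrib_left mult_ac)
      moreover have "c (h k) * of_real (b (\<theta> j)) * torus_char (h k) \<theta> = (\<Prod>i\<in>UNIV. g k i (\<theta> i))" for k
        unfolding torus_char_def g_def by (rule mult_slot_prod[of "\<lambda>t. c (h k) * of_real (b t)"])
      ultimately show ?thesis by simp
    qed
    have bm: "b \<in> borel_measurable circle_measure" "(\<lambda>t. m t * b t) \<in> borel_measurable circle_measure"
      unfolding b_def using m by auto
    have b1: "\<bar>b t\<bar> \<le> 1" "\<bar>m t * b t\<bar> \<le> 1" for t
      using m0[of t] by (auto simp: b_def)
    have gL: "g k i \<in> L2 circle_measure" for k i
      using L2_cmult[OF L2_mult_bounded[OF circle_char_L2 bm(1) b1(1)], of "c (h k)" "h k j"]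
      by (auto simp: g_def circle_char_L2 mult.assoc)
    have mgL: "(\<lambda>t. of_real (m t) * g k j t) \<in> L2 circle_measure" for k
      using L2_cmult[OF L2_mult_bounded[OF circle_char_L2 bm(2) b1(2)], of "c (h k)" "h k j"]
      by (simp add: g_def mult_ac)
    show "(coef torus_measure torus_char (\<lambda>\<theta>. of_real (1 / (1 + m (\<theta> j))) * (\<Sum>n\<in>F. c n * torus_char n \<theta>)),
        coef torus_measure torus_char (\<lambda>\<theta>. of_real (m (\<theta> j)) * (of_real (1 / (1 + m (\<theta> j))) *
          (\<Sum>n\<in>F. c n * torus_char n \<theta>)))) \<in> alg_tensor_slot j (fourier_multiplier circle_measure circle_char m)"
      unfolding alg_tensor_slot_fourier_multiplier_iff eq
      by (intro exI[of _ "card F"] exI[of _ g]) (simp add: gL mgL)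
  qed
qed

subsection \<open>Powers of the Laplacian\<close>

definition pow_symbol :: "real \<Rightarrow> real \<Rightarrow> real" where
  "pow_symbol r \<theta> = laplacian_symbol \<theta> powr r"

lemma pow_symbol_nonneg: "0 \<le> pow_symbol r \<theta>"
  by (simp add: pow_symbol_def)

lemma pow_symbol_measurable_borel [measurable]: "pow_symbol r \<in> borel_measurable borel"
proof -
  have [measurable]: "laplacian_symbol \<in> borel_measurable borel"
    unfolding laplacian_symbol_def by (intro borel_measurable_continuous_onI continuous_intros)
  show ?thesis unfolding pow_symbol_def[abs_def] by measurable
qed

lemma pow_symbol_measurable [measurable]: "pow_symbol r \<in> borel_measurable circle_measure"
  by (rule measurable_circle_measureI[OF pow_symbol_measurable_borel])

lemma pow_symbol_slot_measurable [measurable]: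
  "(\<lambda>\<theta>. pow_symbol r (\<theta> j)) \<in> borel_measurable torus_measure"
  by (rule torus_measurable_slot[OF pow_symbol_measurable])

lemma pow_symbol_slot_mult_measurable:
  assumes "g \<in> L2 torus_measure"
  shows "(\<lambda>\<theta>. of_real (pow_symbol r (\<theta> j)) * g \<theta>) \<in> borel_measurable torus_measure"
proof -
  have [measurable]: "g \<in> borel_measurable torus_measure" using assms by (simp add: L2_def)
  show ?thesis by measurable
qed

section \<open>Bounds and singularity of the symbol\<close>

lemma pow_symbol_le:
  assumes "0 \<le> r" shows "pow_symbol r \<theta> \<le> 4 powr r"
  unfolding pow_symbol_def
proof (rule powr_mono2[OF assms])
  show "0 \<le> laplacian_symbol \<theta>" "laplacian_symbol \<theta> \<le> 4"
    using cos_ge_minus_one[of \<theta>] cos_le_one[of \<theta>] unfolding laplacian_symbol_def by linarith+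
qed

text \<open>By the half-angle formula the symbol of the Laplacian is
  \<open>(2 * sin (\<theta> / 2))\<^sup>2\<close>, at most \<open>\<theta>\<^sup>2\<close>, and a
  negative exponent reverses this. Positivity of the sine matters, because \<open>0 powr r\<close>
  is 0.\<close>

lemma pow_symbol_ge:
  assumes r: "r < 0" and \<theta>: "0 < \<theta>" "\<theta> \<le> pi"
  shows "\<theta> powr (2 * r) \<le> pow_symbol r \<theta>"
proof -
  have s: "laplacian_symbol \<theta> = (2 * sin (\<theta> / 2))\<^sup>2"
    using cos_double_sin[of "\<theta> / 2"] by (simp add: laplacian_symbol_def power_mult_distrib)
  have pos: "0 < sin (\<theta> / 2)" using \<theta> by (intro sin_gt_zero) auto
  have "(2 * sin (\<theta> / 2))\<^sup>2 \<le> \<theta>\<^sup>2"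
    using sin_x_le_x[of "\<theta> / 2"] \<theta> pos by (intro power_mono) auto
  moreover have "0 < (2 * sin (\<theta> / 2))\<^sup>2" using pos by simp
  ultimately have "(\<theta>\<^sup>2) powr r \<le> pow_symbol r \<theta>"
    unfolding pow_symbol_def s using r by (intro powr_mono2') auto
  moreover have "(\<theta>\<^sup>2) powr r = \<theta> powr (2 * r)"
    using \<theta> by (simp add: powr_powr flip: powr_numeral)
  ultimately show ?thesis by simp
qed

text \<open>The witness \<open>\<theta> powr (- 1 / 2 - r)\<close> is square integrable at \<open>0\<close> since \<open>r < 0\<close>; its
  product with the symbol is at least of order \<open>\<theta> powr (r - 1 / 2)\<close>, whose square is not
  integrable.\<close>

lemma pow_symbol_unbounded:
  assumes r: "r < 0"
  obtains g where "g \<in> L2 circle_measure" "(\<lambda>\<theta>. of_real (pow_symbol r \<theta>) * g \<theta>) \<notin> L2 circle_measure"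
proof -
  define g0 where "g0 = (\<lambda>\<theta>::real. if 0 < \<theta> then \<theta> powr (- 1 / 2 - r) else 0)"
  define g where "g = (\<lambda>\<theta>. complex_of_real (g0 \<theta>))"
  have g0m[measurable]: "g0 \<in> borel_measurable borel" unfolding g0_def by measurable
  have gm: "g \<in> borel_measurable circle_measure"
    unfolding g_def by (intro measurable_circle_measureI) measurable
  \<comment> \<open>The exponent exceeds \<open>- 1\<close> because \<open>r < 0\<close>, which
    makes the right-hand side integrable at 0.\<close>
  have sq: "(cmod (g \<theta>))\<^sup>2 = \<theta> powr (- 1 - 2 * r)" if "0 < \<theta>" for \<theta>
    using that by (simp add: g_def g0_def powr_powr flip: powr_numeral) (simp add: algebra_simps)
  have gL: "g \<in> L2 circle_measure"
  proof -
    have I: "((\<lambda>\<theta>. \<theta> powr (- 1 - 2 * r)) has_integral (pi powr (- 2 * r) / (- 2 * r))) {0..pi}"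
      using has_integral_powr_from_0[of "- 1 - 2 * r" pi] r by simp
    have "(\<integral>\<^sup>+\<theta>. ennreal ((cmod (g \<theta>))\<^sup>2) \<partial>circle_measure)
        = (\<integral>\<^sup>+\<theta>. ennreal ((cmod (g \<theta>))\<^sup>2) * indicator {-pi..pi} \<theta> \<partial>lborel)"
      unfolding circle_measure_def by (subst nn_integral_restrict_space) auto
    also have "\<dots> \<le> (\<integral>\<^sup>+\<theta>. ennreal (indicator {0..pi} \<theta> * \<theta> powr (- 1 - 2 * r)) \<partial>lborel)"
    proof (rule nn_integral_mono)
      fix \<theta> :: real
      show "ennreal ((cmod (g \<theta>))\<^sup>2) * indicator {-pi..pi} \<theta> \<le> ennreal (indicator {0..pi} \<theta> * \<theta> powr (- 1 - 2 * r))"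
      proof (cases "0 < \<theta>")
        case True
        then show ?thesis by (simp add: sq indicator_def)
      next
        case False
        then show ?thesis by (simp add: g_def g0_def)
      qed
    qed
    also have "\<dots> = ennreal (pi powr (- 2 * r) / (- 2 * r))"
      by (rule nn_integral_has_integral_lebesgue[OF _ I]) simp
    also have "\<dots> < \<infinity>" by simp
    finally have "integrable circle_measure (\<lambda>\<theta>. (cmod (g \<theta>))\<^sup>2)"
      using gm by (intro integrableI_nonneg) auto
    then show ?thesis using gm by (simp add: L2_def)
  qed
  have "(\<lambda>\<theta>. of_real (pow_symbol r \<theta>) * g \<theta>) \<notin> L2 circle_measure"
  proof
    assume "(\<lambda>\<theta>. of_real (pow_symbol r \<theta>) * g \<theta>) \<in> L2 circle_measure"
    then have int: "integrable circle_measure (\<lambda>\<theta>. (cmod (of_real (pow_symbol r \<theta>) * g \<theta>))\<^sup>2)"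
      by (simp add: L2_def)
    define V where "V = (\<integral>\<theta>. (cmod (of_real (pow_symbol r \<theta>) * g \<theta>))\<^sup>2 \<partial>circle_measure)"
    have V0: "0 \<le> V" by (simp add: V_def)
    have V: "(\<integral>\<^sup>+\<theta>. ennreal ((cmod (of_real (pow_symbol r \<theta>) * g \<theta>))\<^sup>2) * indicator {-pi..pi} \<theta> \<partial>lborel) = ennreal V"
    proof -
      have "(\<integral>\<^sup>+\<theta>. ennreal ((cmod (of_real (pow_symbol r \<theta>) * g \<theta>))\<^sup>2) \<partial>circle_measure) = ennreal V"
        unfolding V_def by (rule nn_integral_eq_integral[OF int]) simp
      then show ?thesis
        unfolding circle_measure_def by (simp add: nn_integral_restrict_space)
    qed
    \<comment> \<open>On the positive half the squared product is at least
      \<open>\<theta> powr (2 * r - 1)\<close>, and \<open>\<theta> powr (2 * r)\<close> is smallest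
      at \<open>pi\<close>: this gives the lower bound \<open>c / \<theta>\<close>, whose
      antiderivative is logarithmic.\<close>
    define c where "c = pi powr (2 * r)"
    have c: "0 < c" by (simp add: c_def)
    have low: "c / \<theta> \<le> (cmod (of_real (pow_symbol r \<theta>) * g \<theta>))\<^sup>2" if \<theta>: "0 < \<theta>" "\<theta> \<le> pi" for \<theta>
    proof -
      have "c \<le> \<theta> powr (2 * r)"
        unfolding c_def using r \<theta> by (intro powr_mono2') auto
      then have "c / \<theta> \<le> \<theta> powr (2 * r) / \<theta>"
        using \<theta> by (intro divide_right_mono) auto
      also have "\<dots> = (\<theta> powr (2 * r) * \<theta> powr (- 1 / 2 - r))\<^sup>2"
      proof -
        have "(\<theta> powr (2 * r) * \<theta> powr (- 1 / 2 - r))\<^sup>2 = \<theta> powr (2 * (2 * r + (- 1 / 2 - r)))"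
          unfolding powr_add[symmetric] power2_eq_square mult_2 ..
        also have "2 * (2 * r + (- 1 / 2 - r)) = 2 * r - 1" by simp
        finally show ?thesis using \<theta> by (simp add: powr_diff)
      qed
      also have "\<dots> \<le> (cmod (of_real (pow_symbol r \<theta>) * g \<theta>))\<^sup>2"
        using pow_symbol_ge[OF r \<theta>] \<theta> pow_symbol_nonneg[of r \<theta>]
        by (intro power_mono) (auto simp: g_def g0_def norm_mult intro!: mult_right_mono)
      finally show ?thesis .
    qed
    \<comment> \<open>Chosen so that \<open>- c * ln \<epsilon> = V\<close>: the integral of
      \<open>c / \<theta>\<close> over \<open>{\<epsilon>..pi}\<close> is then
      \<open>V + c * ln pi\<close>, which exceeds \<open>V\<close>.\<close>
    define \<epsilon> where "\<epsilon> = exp (- V / c)"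
    have \<epsilon>: "0 < \<epsilon>" "\<epsilon> \<le> 1" using V0 c by (auto simp: \<epsilon>_def)
    have \<epsilon>pi: "\<epsilon> \<le> pi" using \<epsilon>(2) pi_ge_two by linarith
    have "ennreal (c * ln pi - c * ln \<epsilon>) = (\<integral>\<^sup>+\<theta>. ennreal (c / \<theta>) * indicator {\<epsilon>..pi} \<theta> \<partial>lborel)"
      using c \<epsilon> \<epsilon>pi
      by (intro nn_integral_FTC_Icc[symmetric]) (auto intro!: derivative_eq_intros simp flip: has_real_derivative_iff_has_vector_derivative)
    also have "\<dots> \<le> (\<integral>\<^sup>+\<theta>. ennreal ((cmod (of_real (pow_symbol r \<theta>) * g \<theta>))\<^sup>2) * indicator {-pi..pi} \<theta> \<partial>lborel)"
      using low \<epsilon> by (intro nn_integral_mono) (auto simp: indicator_def intro!: ennreal_leI)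
    finally have "c * ln pi - c * ln \<epsilon> \<le> V" unfolding V using V0 by (simp add: ennreal_le_iff)
    moreover have "c * ln \<epsilon> = - V" using c by (simp add: \<epsilon>_def)
    moreover have "0 < ln pi" using pi_ge_two by (intro ln_gt_zero) auto
    ultimately show False using c by (simp add: mult_le_0_iff)
  qed
  then show ?thesis using gL by (rule that[rotated])
qed

text \<open>The singular one-variable function sits in slot \<open>j\<close> and the constant 1
  elsewhere; by Tonelli the integral of the squared modulus is a product with an infinite
  factor.\<close>

lemma pow_symbol_slot_unbounded:
  fixes j :: "'d::finite"
  assumes r: "r < 0"
  obtains G where "G \<in> L2 torus_measure" "(\<lambda>\<theta>. of_real (pow_symbol r (\<theta> j)) * G \<theta>) \<notin> L2 torus_measure"
proof -
  obtain g where g: "g \<in> L2 circle_measure" and ng: "(\<lambda>t. of_real (pow_symbol r t) * g t) \<notin> L2 circle_measure"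
    using pow_symbol_unbounded[OF r] .
  have [measurable]: "g \<in> borel_measurable circle_measure" using g by (simp add: L2_def)
  define G where "G = (\<lambda>\<theta> :: 'd \<Rightarrow> real. \<Prod>i\<in>UNIV. ((\<lambda>_ _. 1)(j := g)) i (\<theta> i))"
  define h where "h = (\<lambda>i t. if i = j then of_real (pow_symbol r t) * g t else 1)"
  have GL: "G \<in> L2 torus_measure"
    unfolding G_def by (rule L2_torus_prod(1)) (use g in \<open>auto simp: L2_def circle.finite_measure_axioms\<close>)
  have mG: "of_real (pow_symbol r (\<theta> j)) * G \<theta> = (\<Prod>i\<in>UNIV. h i (\<theta> i))" for \<theta>
    unfolding G_def mult_slot_prod[of "\<lambda>t. of_real (pow_symbol r t)"] h_def
    by (intro prod.cong) auto
  have [measurable]: "h i \<in> borel_measurable circle_measure" for i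
    unfolding h_def by (cases "i = j") simp_all
  have "(\<integral>\<^sup>+t. ennreal ((cmod (h j t))\<^sup>2) \<partial>circle_measure) = \<infinity>"
  proof (rule ccontr)
    assume "\<not> ?thesis"
    then have "integrable circle_measure (\<lambda>t. (cmod (h j t))\<^sup>2)"
      by (intro integrableI_nonneg) (auto simp: h_def less_top)
    then show False using ng by (simp add: L2_def h_def)
  qed
  \<comment> \<open>In \<open>ennreal\<close> infinity times 0 is 0, so the remaining factors must
    be shown to be nonzero.\<close>
  moreover have "(\<integral>\<^sup>+t. ennreal ((cmod (h i t))\<^sup>2) \<partial>circle_measure) \<noteq> 0" if "i \<noteq> j" for i
    using that by (simp add: h_def circle_measure_def emeasure_restrict_space space_restrict_space)
  ultimately have top: "(\<Prod>i\<in>UNIV. \<integral>\<^sup>+t. ennreal ((cmod (h i t))\<^sup>2) \<partial>circle_measure) = \<infinity>"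
    by (subst prod.remove[of UNIV j]) (auto simp: ennreal_top_mult)
  have "(\<lambda>\<theta>. of_real (pow_symbol r (\<theta> j)) * G \<theta>) \<notin> L2 torus_measure"
  proof
    assume "(\<lambda>\<theta>. of_real (pow_symbol r (\<theta> j)) * G \<theta>) \<in> L2 torus_measure"
    then have "integrable torus_measure (\<lambda>\<theta>. (cmod (\<Prod>i\<in>UNIV. h i (\<theta> i)))\<^sup>2)"
      by (simp add: L2_def mG)
    then have "(\<integral>\<^sup>+\<theta>. ennreal ((cmod (\<Prod>i\<in>UNIV. h i (\<theta> i)))\<^sup>2) \<partial>torus_measure) \<noteq> \<infinity>"
      by (subst nn_integral_eq_integral) auto
    also have "(\<integral>\<^sup>+\<theta>. ennreal ((cmod (\<Prod>i\<in>UNIV. h i (\<theta> i)))\<^sup>2) \<partial>torus_measure) =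
        (\<integral>\<^sup>+\<theta>. (\<Prod>i\<in>UNIV. ennreal ((cmod (h i (\<theta> i)))\<^sup>2)) \<partial>torus_measure)"
      by (simp add: prod_norm[symmetric] prod_power_distrib prod_ennreal)
    also have "\<dots> = (\<Prod>i\<in>UNIV. \<integral>\<^sup>+t. ennreal ((cmod (h i t))\<^sup>2) \<partial>circle_measure)"
      unfolding torus_measure_def by (rule circle_prod.product_nn_integral_prod) auto
    finally show False using top by simp
  qed
  with GL show ?thesis by (rule that)
qed

section \<open>Domains of the operators\<close>

lemma Domain_laplacian_pow_lattice:
  "Domain (laplacian_pow_lattice r) = coef torus_measure torus_char `
    {g \<in> L2 torus_measure. \<forall>j. (\<lambda>\<theta>. of_real (pow_symbol (r j) (\<theta> j)) * g \<theta>) \<in> L2 torus_measure}"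
proof -
  have iff: "(\<lambda>\<theta>. of_real (\<Sum>j\<in>UNIV. pow_symbol (r j) (\<theta> j)) * g \<theta>) \<in> L2 torus_measure \<longleftrightarrow>
      (\<forall>j. (\<lambda>\<theta>. of_real (pow_symbol (r j) (\<theta> j)) * g \<theta>) \<in> L2 torus_measure)"
    if g: "g \<in> L2 torus_measure" for g
  proof
    assume L: "(\<lambda>\<theta>. of_real (\<Sum>j\<in>UNIV. pow_symbol (r j) (\<theta> j)) * g \<theta>) \<in> L2 torus_measure"
    show "\<forall>j. (\<lambda>\<theta>. of_real (pow_symbol (r j) (\<theta> j)) * g \<theta>) \<in> L2 torus_measure"
    proof
      fix j
      show "(\<lambda>\<theta>. of_real (pow_symbol (r j) (\<theta> j)) * g \<theta>) \<in> L2 torus_measure"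
      proof (rule L2_dominated[OF L])
        show "(\<lambda>\<theta>. of_real (pow_symbol (r j) (\<theta> j)) * g \<theta>) \<in> borel_measurable torus_measure"
          using pow_symbol_slot_mult_measurable[OF g] .
        fix \<theta>
        have "pow_symbol (r j) (\<theta> j) \<le> (\<Sum>j\<in>UNIV. pow_symbol (r j) (\<theta> j))"
          by (intro member_le_sum) (auto simp: pow_symbol_nonneg)
        then show "cmod (of_real (pow_symbol (r j) (\<theta> j)) * g \<theta>) \<le>
            cmod (of_real (\<Sum>j\<in>UNIV. pow_symbol (r j) (\<theta> j)) * g \<theta>)"
          unfolding norm_mult norm_of_real
          by (intro mult_right_mono) (auto simp: pow_symbol_nonneg sum_nonneg)
      qed
    qed
  next
    assume "\<forall>j. (\<lambda>\<theta>. of_real (pow_symbol (r j) (\<theta> j)) * g \<theta>) \<in> L2 torus_measure"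
    then show "(\<lambda>\<theta>. of_real (\<Sum>j\<in>UNIV. pow_symbol (r j) (\<theta> j)) * g \<theta>) \<in> L2 torus_measure"
      unfolding of_real_sum sum_distrib_right by (intro L2_sum) auto
  qed
  show ?thesis
    unfolding laplacian_pow_lattice_def pow_symbol_def[symmetric] torus.Domain_fourier_multiplier
    using iff by (intro arg_cong[where f = "image _"]) blast
qed

lemma Domain_tensor_slot_laplacian_pow:
  "Domain (tensor_slot j (laplacian_pow r)) = coef torus_measure torus_char `
    {g \<in> L2 torus_measure. (\<lambda>\<theta>. of_real (pow_symbol r (\<theta> j)) * g \<theta>) \<in> L2 torus_measure}"
  unfolding laplacian_pow_def pow_symbol_def[symmetric]
    tensor_slot_fourier_multiplier[OF pow_symbol_measurable pow_symbol_nonneg]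
  by (rule torus.Domain_fourier_multiplier)

text \<open>Equal coefficients mean equality almost everywhere, by totality, so the domain condition
  depends on the sequence and not on the function that represents it.\<close>

lemma pow_symbol_slot_cong:
  fixes j :: "'d::finite"
  assumes "g \<in> L2 torus_measure" "h \<in> L2 torus_measure"
    and "coef torus_measure torus_char g = coef torus_measure torus_char h"
    and "(\<lambda>\<theta>. of_real (pow_symbol r (\<theta> j)) * g \<theta>) \<in> L2 torus_measure"
  shows "(\<lambda>\<theta>. of_real (pow_symbol r (\<theta> j)) * h \<theta>) \<in> L2 torus_measure"
proof (rule L2_cong_AE[OF assms(4)])
  show "(\<lambda>\<theta>. of_real (pow_symbol r (\<theta> j)) * h \<theta>) \<in> borel_measurable torus_measure"
    by (rule pow_symbol_slot_mult_measurable[OF assms(2)])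
  have "AE \<theta> in torus_measure. g \<theta> = h \<theta>"
    using assms torus.coef_eq_iff_AE by blast
  then show "AE \<theta> in torus_measure. of_real (pow_symbol r (\<theta> j)) * g \<theta> = of_real (pow_symbol r (\<theta> j)) * h \<theta>"
    by eventually_elim simp
qed

theorem proposition2p8:
  fixes r :: "'d::finite \<Rightarrow> real"
  shows "Domain (laplacian_pow_lattice r) = (\<Inter>j. Domain (tensor_slot j (laplacian_pow (r j))))
    \<and> ((\<forall>j. 0 \<le> r j) \<longrightarrow> Domain (laplacian_pow_lattice r) = ell2)
    \<and> ((\<exists>j. r j < 0) \<longrightarrow> Domain (laplacian_pow_lattice r) \<subset> ell2)"
proof (intro conjI impI)
  let ?C = "coef torus_measure torus_char :: (('d \<Rightarrow> real) \<Rightarrow> complex) \<Rightarrow> _"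
  let ?m = "\<lambda>j (g :: ('d \<Rightarrow> real) \<Rightarrow> complex) \<theta>. of_real (pow_symbol (r j) (\<theta> j)) * g \<theta>"
  show "Domain (laplacian_pow_lattice r) = (\<Inter>j. Domain (tensor_slot j (laplacian_pow (r j))))"
  proof (rule antisym)
    show "Domain (laplacian_pow_lattice r) \<subseteq> (\<Inter>j. Domain (tensor_slot j (laplacian_pow (r j))))"
      unfolding Domain_laplacian_pow_lattice Domain_tensor_slot_laplacian_pow by blast
    show "(\<Inter>j. Domain (tensor_slot j (laplacian_pow (r j)))) \<subseteq> Domain (laplacian_pow_lattice r)"
    proof
      fix f assume f: "f \<in> (\<Inter>j. Domain (tensor_slot j (laplacian_pow (r j))))"
      have ex: "\<exists>g. g \<in> L2 torus_measure \<and> ?m j g \<in> L2 torus_measure \<and> f = ?C g" for j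
        using f unfolding Domain_tensor_slot_laplacian_pow by blast
      \<comment> \<open>One function is fixed for \<open>f\<close>; each slot supplies its own
        \<open>h\<close> with the same coefficients, and square integrability of the product passes
        from \<open>h\<close> to \<open>g\<close>.\<close>
      obtain g where g: "g \<in> L2 torus_measure" "f = ?C g" using ex by blast
      have "?m j g \<in> L2 torus_measure" for j
      proof -
        obtain h where h: "h \<in> L2 torus_measure" "?m j h \<in> L2 torus_measure" "f = ?C h"
          using ex[of j] by blast
        show ?thesis
          by (rule pow_symbol_slot_cong[OF h(1) g(1) _ h(2)]) (use g h in simp)
      qed
      then show "f \<in> Domain (laplacian_pow_lattice r)"
        unfolding Domain_laplacian_pow_lattice using g by blast
    qed
  qed
  show "Domain (laplacian_pow_lattice r) = ell2" if r: "\<forall>j. 0 \<le> r j"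
  proof -
    have "?m j g \<in> L2 torus_measure" if "g \<in> L2 torus_measure" for j g
      using r pow_symbol_le pow_symbol_nonneg
      by (intro L2_mult_bounded[where C = "4 powr r j"] that pow_symbol_slot_measurable) auto
    then show ?thesis
      unfolding Domain_laplacian_pow_lattice torus.ell2_eq_coef_image
      by (intro arg_cong[where f = "image _"]) blast
  qed
  show "Domain (laplacian_pow_lattice r) \<subset> ell2" if r: "\<exists>j. r j < 0"
  proof -
    obtain j where j: "r j < 0" using r by blast
    obtain G where G: "G \<in> L2 torus_measure" "?m j G \<notin> L2 torus_measure"
      using pow_symbol_slot_unbounded[OF j, of j] .
    \<comment> \<open>It is not enough that \<open>G\<close> violates the condition: another
      function with the same coefficients could satisfy it, and the transfer between representatives
      excludes this.\<close>
    have "?C G \<notin> Domain (laplacian_pow_lattice r)"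
    proof
      assume "?C G \<in> Domain (laplacian_pow_lattice r)"
      then obtain g where g: "g \<in> L2 torus_measure" "?m j g \<in> L2 torus_measure" "?C G = ?C g"
        unfolding Domain_laplacian_pow_lattice by blast
      have "?m j G \<in> L2 torus_measure"
        by (rule pow_symbol_slot_cong[OF g(1) G(1) _ g(2)]) (use g in simp)
      then show False using G(2) by blast
    qed
    moreover have "?C G \<in> ell2" using G(1) torus.coef_ell2 by blast
    moreover have "Domain (laplacian_pow_lattice r) \<subseteq> ell2"
      unfolding Domain_laplacian_pow_lattice torus.ell2_eq_coef_image by blast
    ultimately show ?thesis by blast
  qed
qed

end
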